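(* Let $R$ be a commutative noetherian ring. Then any automorphism-invariant $R$-module is quasi-injective.
   Context: Rings have an identity and modules are unitary; $E(M)$ denotes the injective envelope of $M$. A module $M$ is automorphism-invariant if $f(M)\subseteq M$ for every automorphism $f$ of $E(M)$, and quasi-injective if $f(M)\subseteq M$ for every endomorphism $f$ of $E(M)$. *)

theory Defs
  imports "HOL-Algebra.Algebra"
begin

definition mod_hom ::
    "('r, 'p) ring_scheme \<Rightarrow> ('r, 'm, 'q) module_scheme \<Rightarrow> ('r, 'n, 's) module_scheme \<Rightarrow> ('m \<Rightarrow> 'n) set"
  where "mod_hom R M N =
    {h \<in> hom (add_monoid M) (add_monoid N).
      \<forall>r \<in> carrier R. \<forall>x \<in> carrier M. h (r \<odot>\<^bsub>M\<^esub> x) = r \<odot>\<^bsub>N\<^esub> h x}"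

definition mod_end :: "('r, 'p) ring_scheme \<Rightarrow> ('r, 'm, 'q) module_scheme \<Rightarrow> ('m \<Rightarrow> 'm) set"
  where "mod_end R M = mod_hom R M M"

definition mod_aut :: "('r, 'p) ring_scheme \<Rightarrow> ('r, 'm, 'q) module_scheme \<Rightarrow> ('m \<Rightarrow> 'm) set"
  where "mod_aut R M = {f \<in> mod_end R M. bij_betw f (carrier M) (carrier M)}"

text \<open>
  A definition cannot quantify over all types, so the modules \<open>A\<close> and \<open>B\<close> range over those whose
  carrier lies in the type of ring elements. By Baer's argument nothing is lost: the lemma
  \<open>injective_module_extend\<close> below gives the extension property for \<open>A\<close> and \<open>B\<close> of arbitrary types.
\<close>

definition injective_module :: "('r, 'p) ring_scheme \<Rightarrow> ('r, 'e, 'q) module_scheme \<Rightarrow> bool"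
  where "injective_module R E \<longleftrightarrow> module R E \<and>
    (\<forall>(A :: ('r, 'r) module) (B :: ('r, 'r) module) g f.
      module R A \<longrightarrow> module R B \<longrightarrow>
      g \<in> mod_hom R A B \<longrightarrow> inj_on g (carrier A) \<longrightarrow> f \<in> mod_hom R A E \<longrightarrow>
      (\<exists>h \<in> mod_hom R B E. \<forall>x \<in> carrier A. h (g x) = f x))"

definition essential_submodule ::
    "'e set \<Rightarrow> ('r, 'p) ring_scheme \<Rightarrow> ('r, 'e, 'q) module_scheme \<Rightarrow> bool"
  where "essential_submodule H R E \<longleftrightarrow> submodule H R E \<and>
    (\<forall>N. submodule N R E \<longrightarrow> N \<inter> H = {\<zero>\<^bsub>E\<^esub>} \<longrightarrow> N = {\<zero>\<^bsub>E\<^esub>})"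

text \<open>
  An injective envelope of \<open>M\<close> is a module \<open>E\<close> together with an embedding \<open>i\<close> of \<open>M\<close>; it is unique
  only up to isomorphism over \<open>M\<close>. In the two notions after it, \<open>M\<close> is identified with its image
  in \<open>E\<close>, and they are only meaningful when \<open>injective_envelope R M E i\<close> holds.
\<close>

definition injective_envelope ::
    "('r, 'p) ring_scheme \<Rightarrow> ('r, 'm, 'q) module_scheme \<Rightarrow> ('r, 'e, 's) module_scheme \<Rightarrow> ('m \<Rightarrow> 'e) \<Rightarrow> bool"
  where "injective_envelope R M E i \<longleftrightarrow>
    module R M \<and> injective_module R E \<and>
    i \<in> mod_hom R M E \<and> inj_on i (carrier M) \<and> essential_submodule (i ` carrier M) R E"

definition automorphism_invariant ::
    "('r, 'p) ring_scheme \<Rightarrow> ('r, 'm, 'q) module_scheme \<Rightarrow> ('r, 'e, 's) module_scheme \<Rightarrow> ('m \<Rightarrow> 'e) \<Rightarrow> bool"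
  where "automorphism_invariant R M E i \<longleftrightarrow>
    (\<forall>f \<in> mod_aut R E. f ` (i ` carrier M) \<subseteq> i ` carrier M)"

definition quasi_injective ::
    "('r, 'p) ring_scheme \<Rightarrow> ('r, 'm, 'q) module_scheme \<Rightarrow> ('r, 'e, 's) module_scheme \<Rightarrow> ('m \<Rightarrow> 'e) \<Rightarrow> bool"
  where "quasi_injective R M E i \<longleftrightarrow>
    (\<forall>f \<in> mod_end R E. f ` (i ` carrier M) \<subseteq> i ` carrier M)"

lemma mod_homI:
  assumes "\<And>x. x \<in> carrier M \<Longrightarrow> h x \<in> carrier N"
    and "\<And>x y. x \<in> carrier M \<Longrightarrow> y \<in> carrier M \<Longrightarrow> h (x \<oplus>\<^bsub>M\<^esub> y) = h x \<oplus>\<^bsub>N\<^esub> h y"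
    and "\<And>r x. r \<in> carrier R \<Longrightarrow> x \<in> carrier M \<Longrightarrow> h (r \<odot>\<^bsub>M\<^esub> x) = r \<odot>\<^bsub>N\<^esub> h x"
  shows "h \<in> mod_hom R M N"
  using assms by (auto simp: mod_hom_def hom_def)

lemma mod_homD:
  assumes "h \<in> mod_hom R M N"
  shows "\<And>x. x \<in> carrier M \<Longrightarrow> h x \<in> carrier N"
    and "\<And>x y. x \<in> carrier M \<Longrightarrow> y \<in> carrier M \<Longrightarrow> h (x \<oplus>\<^bsub>M\<^esub> y) = h x \<oplus>\<^bsub>N\<^esub> h y"
    and "\<And>r x. r \<in> carrier R \<Longrightarrow> x \<in> carrier M \<Longrightarrow> h (r \<odot>\<^bsub>M\<^esub> x) = r \<odot>\<^bsub>N\<^esub> h x"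
  using assms by (auto simp: mod_hom_def hom_def)

definition ring_as_module :: "('r, 'p) ring_scheme \<Rightarrow> ('r, 'r) module"
  where "ring_as_module R =
    \<lparr>carrier = carrier R, monoid.mult = monoid.mult R, one = one R, ring.zero = ring.zero R, ring.add = ring.add R,
     smult = monoid.mult R\<rparr>"

lemma ring_as_module_module:
  assumes "cring R"
  shows "module R (ring_as_module R)"
proof -
  interpret cring R by fact
  show ?thesis
  proof (rule moduleI)
    show "abelian_group (ring_as_module R)"
      by (rule abelian_groupI)
        (auto simp: ring_as_module_def a_ac intro: l_neg bexI[of _ "\<ominus>\<^bsub>R\<^esub> _"])
  qed (auto simp: ring_as_module_def l_distr r_distr m_assoc is_cring)
qed

lemma injective_module_extend:
  fixes R :: "('r, 'p) ring_scheme"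
    and E :: "('r, 'e, 'q) module_scheme"
    and A :: "('r, 'a, 's) module_scheme"
    and B :: "('r, 'b, 't) module_scheme"
  assumes E: "injective_module R E"
    and A: "module R A" and B: "module R B"
    and g: "g \<in> mod_hom R A B" "inj_on g (carrier A)"
    and f: "f \<in> mod_hom R A E"
  shows "\<exists>h \<in> mod_hom R B E. \<forall>x \<in> carrier A. h (g x) = f x"
proof -
  have EM: "module R E" using E by (simp add: injective_module_def)
  interpret A: module R A by fact
  interpret B: module R B by fact
  interpret E: module R E by fact
  note gD = mod_homD[OF g(1)] and fD = mod_homD[OF f]
  define lin where "lin G \<longleftrightarrow> G \<subseteq> carrier B \<times> carrier E \<and>
      (\<forall>x y x' y'. (x,y) \<in> G \<longrightarrow> (x',y') \<in> G \<longrightarrow> (x \<oplus>\<^bsub>B\<^esub> x', y \<oplus>\<^bsub>E\<^esub> y') \<in> G) \<and>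
      (\<forall>r\<in>carrier R. \<forall>x y. (x,y) \<in> G \<longrightarrow> (r \<odot>\<^bsub>B\<^esub> x, r \<odot>\<^bsub>E\<^esub> y) \<in> G) \<and>
      (\<forall>x y y'. (x,y) \<in> G \<longrightarrow> (x,y') \<in> G \<longrightarrow> y = y')" for G
  define G0 where "G0 = (\<lambda>a. (g a, f a)) ` carrier A"
  define S where "S = {G. lin G \<and> G0 \<subseteq> G}"
  have "lin G0"
    unfolding lin_def
  proof (intro conjI allI impI ballI)
    show "G0 \<subseteq> carrier B \<times> carrier E" by (auto simp: G0_def gD fD)
    show "(x \<oplus>\<^bsub>B\<^esub> x', y \<oplus>\<^bsub>E\<^esub> y') \<in> G0" if "(x,y) \<in> G0" "(x',y') \<in> G0" for x y x' y'
    proof -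
      from that obtain a a' where "a \<in> carrier A" "a' \<in> carrier A"
        "x = g a" "y = f a" "x' = g a'" "y' = f a'" by (auto simp: G0_def)
      thus ?thesis unfolding G0_def
        by (intro image_eqI[of _ _ "a \<oplus>\<^bsub>A\<^esub> a'"]) (auto simp: gD fD)
    qed
    show "(r \<odot>\<^bsub>B\<^esub> x, r \<odot>\<^bsub>E\<^esub> y) \<in> G0" if "r \<in> carrier R" "(x,y) \<in> G0" for r x y
    proof -
      from that obtain a where "a \<in> carrier A" "x = g a" "y = f a" by (auto simp: G0_def)
      thus ?thesis unfolding G0_def using that
        by (intro image_eqI[of _ _ "r \<odot>\<^bsub>A\<^esub> a"]) (auto simp: gD fD)
    qed
    show "y = y'" if "(x,y) \<in> G0" "(x,y') \<in> G0" for x y y'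
      using that inj_onD[OF g(2)] by (auto simp: G0_def)
  qed
  hence "S \<noteq> {}" by (auto simp: S_def)
  moreover have "\<Union>C \<in> S" if C: "C \<noteq> {}" "subset.chain S C" for C
  proof -
    have mem: "lin G \<and> G0 \<subseteq> G" if "G \<in> C" for G
      using that C by (auto simp: subset_chain_def S_def)
    have two: "\<exists>G\<in>C. p \<in> G \<and> q \<in> G" if "p \<in> \<Union>C" "q \<in> \<Union>C" for p q
      using that C(2) unfolding subset_chain_def by (meson UnionE subsetD)
    have "lin (\<Union>C)"
      unfolding lin_def
    proof (intro conjI allI impI ballI)
      show "\<Union>C \<subseteq> carrier B \<times> carrier E" using mem unfolding lin_def by blast
      show "(x \<oplus>\<^bsub>B\<^esub> x', y \<oplus>\<^bsub>E\<^esub> y') \<in> \<Union>C" if "(x,y) \<in> \<Union>C" "(x',y') \<in> \<Union>C" for x y x' y'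
        using two[OF that] mem unfolding lin_def by blast
      show "(r \<odot>\<^bsub>B\<^esub> x, r \<odot>\<^bsub>E\<^esub> y) \<in> \<Union>C" if "r \<in> carrier R" "(x,y) \<in> \<Union>C" for r x y
        using that mem unfolding lin_def by blast
      show "y = y'" if "(x,y) \<in> \<Union>C" "(x,y') \<in> \<Union>C" for x y y'
        using two[OF that] mem unfolding lin_def by blast
    qed
    thus ?thesis using mem C(1) by (auto simp: S_def)
  qed
  ultimately obtain G where GS: "G \<in> S" and Gmax: "\<And>W. W \<in> S \<Longrightarrow> G \<subseteq> W \<Longrightarrow> W = G"
    using subset_Zorn_nonempty[of S] by blast
  have linG: "lin G" and G0G: "G0 \<subseteq> G" using GS by (auto simp: S_def)
  have Gc: "x \<in> carrier B" "y \<in> carrier E" if "(x,y) \<in> G" for x y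
    using linG that unfolding lin_def by blast+
  have Ga: "(x \<oplus>\<^bsub>B\<^esub> x', y \<oplus>\<^bsub>E\<^esub> y') \<in> G" if "(x,y) \<in> G" "(x',y') \<in> G" for x y x' y'
    using linG that unfolding lin_def by blast
  have Gs: "(r \<odot>\<^bsub>B\<^esub> x, r \<odot>\<^bsub>E\<^esub> y) \<in> G" if "r \<in> carrier R" "(x,y) \<in> G" for r x y
    using linG that unfolding lin_def by blast
  have Gf: "y = y'" if "(x,y) \<in> G" "(x,y') \<in> G" for x y y'
    using linG that unfolding lin_def by blast
  have G_zero: "(\<zero>\<^bsub>B\<^esub>, \<zero>\<^bsub>E\<^esub>) \<in> G"
  proof -
    have "(g \<zero>\<^bsub>A\<^esub>, f \<zero>\<^bsub>A\<^esub>) \<in> G" using G0G by (auto simp: G0_def)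
    from Gs[OF A.R.zero_closed this] Gc[OF this] show ?thesis by simp
  qed
  have Gn: "(\<ominus>\<^bsub>B\<^esub> x, \<ominus>\<^bsub>E\<^esub> y) \<in> G" if "(x,y) \<in> G" for x y
    using Gs[of "\<ominus>\<^bsub>R\<^esub> \<one>\<^bsub>R\<^esub>" x y] that Gc[OF that]
    by (simp add: B.smult_l_minus E.smult_l_minus)
  have total: "b \<in> Domain G" if b: "b \<in> carrier B" for b
  proof (rule ccontr)
    assume nb: "b \<notin> Domain G"
    let ?R = "ring_as_module R"
    define I where "I = {r \<in> carrier R. r \<odot>\<^bsub>B\<^esub> b \<in> Domain G}"
    define \<phi> where "\<phi> r = (THE e. (r \<odot>\<^bsub>B\<^esub> b, e) \<in> G)" for r
    have \<phi>eq: "\<phi> r = e" if "(r \<odot>\<^bsub>B\<^esub> b, e) \<in> G" for r e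
      unfolding \<phi>_def using that Gf by blast
    have \<phi>: "(r \<odot>\<^bsub>B\<^esub> b, \<phi> r) \<in> G" if "r \<in> I" for r
      using that \<phi>eq by (auto simp: I_def)
    have Ic: "r \<in> carrier R" if "r \<in> I" for r using that by (simp add: I_def)
    have Iadd: "((r \<oplus>\<^bsub>R\<^esub> s) \<odot>\<^bsub>B\<^esub> b, \<phi> r \<oplus>\<^bsub>E\<^esub> \<phi> s) \<in> G" if "r \<in> I" "s \<in> I" for r s
      using Ga[OF \<phi>[OF that(1)] \<phi>[OF that(2)]] b Ic[OF that(1)] Ic[OF that(2)]
      by (simp add: B.smult_l_distr)
    have Imul: "((s \<otimes>\<^bsub>R\<^esub> r) \<odot>\<^bsub>B\<^esub> b, s \<odot>\<^bsub>E\<^esub> \<phi> r) \<in> G" if "r \<in> I" "s \<in> carrier R" for r s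
      using Gs[OF that(2) \<phi>[OF that(1)]] b Ic[OF that(1)] that(2) by (simp add: B.smult_assoc1)
    have Rm: "module R ?R" by (rule ring_as_module_module) (rule A.R.is_cring)
    interpret Rm: module R ?R by fact
    have Rsimps: "carrier ?R = carrier R" "ring.add ?R = ring.add R" "smult ?R = monoid.mult R"
      "ring.zero ?R = ring.zero R" by (simp_all add: ring_as_module_def)
    have subI: "submodule I R ?R"
    proof (rule Rm.submoduleI)
      show "I \<subseteq> carrier ?R" using Ic by (auto simp: Rsimps)
      show "\<zero>\<^bsub>?R\<^esub> \<in> I" using G_zero b by (auto simp: Rsimps I_def)
      show add: "r \<oplus>\<^bsub>?R\<^esub> s \<in> I" if "r \<in> I" "s \<in> I" for r s
        using Iadd[OF that] Ic[OF that(1)] Ic[OF that(2)] by (auto simp: Rsimps I_def)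
      show mul: "s \<odot>\<^bsub>?R\<^esub> r \<in> I" if "s \<in> carrier R" "r \<in> I" for r s
        using Imul[OF that(2,1)] Ic[OF that(2)] that(1) by (auto simp: Rsimps I_def)
      show "\<ominus>\<^bsub>?R\<^esub> r \<in> I" if "r \<in> I" for r
      proof -
        have r: "r \<in> carrier ?R" using Ic[OF that] by (simp add: Rsimps)
        have "(\<ominus>\<^bsub>R\<^esub> \<one>\<^bsub>R\<^esub>) \<odot>\<^bsub>?R\<^esub> r = \<ominus>\<^bsub>?R\<^esub> r"
          using Rm.smult_l_minus[OF A.R.one_closed r] Rm.smult_one[OF r] by simp
        thus ?thesis using mul[of "\<ominus>\<^bsub>R\<^esub> \<one>\<^bsub>R\<^esub>" r] that by simp
      qed
    qed
    have Im: "module R (?R\<lparr>carrier := I\<rparr>)"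
      by (rule submodule.submodule_is_module[OF subI Rm])
    have idh: "(\<lambda>x. x) \<in> mod_hom R (?R\<lparr>carrier := I\<rparr>) ?R"
      by (rule mod_homI) (auto simp: Rsimps Ic)
    have \<phi>h: "\<phi> \<in> mod_hom R (?R\<lparr>carrier := I\<rparr>) E"
      by (rule mod_homI) (auto simp: Rsimps intro: Gc \<phi> \<phi>eq Iadd Imul)
    obtain h where h: "h \<in> mod_hom R ?R E" and h\<phi>: "\<And>r. r \<in> I \<Longrightarrow> h r = \<phi> r"
      using E[unfolded injective_module_def] Im Rm idh \<phi>h by fastforce
    define e0 where "e0 = h \<one>\<^bsub>R\<^esub>"
    have e0: "e0 \<in> carrier E" using mod_homD(1)[OF h] by (simp add: e0_def Rsimps)
    have he0: "h r = r \<odot>\<^bsub>E\<^esub> e0" if "r \<in> carrier R" for r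
      using mod_homD(3)[OF h that, of "\<one>\<^bsub>R\<^esub>"] that by (simp add: e0_def Rsimps)
    define H where "H = {(x \<oplus>\<^bsub>B\<^esub> r \<odot>\<^bsub>B\<^esub> b, y \<oplus>\<^bsub>E\<^esub> r \<odot>\<^bsub>E\<^esub> e0) | x y r. (x,y) \<in> G \<and> r \<in> carrier R}"
    have HI: "(x \<oplus>\<^bsub>B\<^esub> r \<odot>\<^bsub>B\<^esub> b, y \<oplus>\<^bsub>E\<^esub> r \<odot>\<^bsub>E\<^esub> e0) \<in> H" if "(x,y) \<in> G" "r \<in> carrier R" for x y r
      using that by (auto simp: H_def)
    have HE: "\<exists>x y r. (x,y) \<in> G \<and> r \<in> carrier R \<and> u = x \<oplus>\<^bsub>B\<^esub> r \<odot>\<^bsub>B\<^esub> b \<and> v = y \<oplus>\<^bsub>E\<^esub> r \<odot>\<^bsub>E\<^esub> e0"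
      if "(u,v) \<in> H" for u v
      using that by (auto simp: H_def)
    have linH: "lin H"
      unfolding lin_def
    proof (intro conjI allI impI ballI)
      show "H \<subseteq> carrier B \<times> carrier E" using b e0 by (auto simp: H_def dest: Gc)
      show "(u \<oplus>\<^bsub>B\<^esub> u', v \<oplus>\<^bsub>E\<^esub> v') \<in> H" if "(u,v) \<in> H" "(u',v') \<in> H" for u v u' v'
      proof -
        from HE[OF that(1)] HE[OF that(2)] obtain x y r x' y' r' where *:
          "(x,y) \<in> G" "r \<in> carrier R" "u = x \<oplus>\<^bsub>B\<^esub> r \<odot>\<^bsub>B\<^esub> b" "v = y \<oplus>\<^bsub>E\<^esub> r \<odot>\<^bsub>E\<^esub> e0"
          "(x',y') \<in> G" "r' \<in> carrier R" "u' = x' \<oplus>\<^bsub>B\<^esub> r' \<odot>\<^bsub>B\<^esub> b" "v' = y' \<oplus>\<^bsub>E\<^esub> r' \<odot>\<^bsub>E\<^esub> e0"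
          by blast
        have "u \<oplus>\<^bsub>B\<^esub> u' = (x \<oplus>\<^bsub>B\<^esub> x') \<oplus>\<^bsub>B\<^esub> (r \<oplus>\<^bsub>R\<^esub> r') \<odot>\<^bsub>B\<^esub> b"
          using * b Gc by (simp add: B.smult_l_distr B.M.add.m_ac)
        moreover have "v \<oplus>\<^bsub>E\<^esub> v' = (y \<oplus>\<^bsub>E\<^esub> y') \<oplus>\<^bsub>E\<^esub> (r \<oplus>\<^bsub>R\<^esub> r') \<odot>\<^bsub>E\<^esub> e0"
          using * e0 Gc by (simp add: E.smult_l_distr E.M.add.m_ac)
        ultimately show ?thesis using HI[OF Ga[OF *(1,5)], of "r \<oplus>\<^bsub>R\<^esub> r'"] * by simp
      qed
      show "(s \<odot>\<^bsub>B\<^esub> u, s \<odot>\<^bsub>E\<^esub> v) \<in> H" if "s \<in> carrier R" "(u,v) \<in> H" for s u v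
      proof -
        from HE[OF that(2)] obtain x y r where *:
          "(x,y) \<in> G" "r \<in> carrier R" "u = x \<oplus>\<^bsub>B\<^esub> r \<odot>\<^bsub>B\<^esub> b" "v = y \<oplus>\<^bsub>E\<^esub> r \<odot>\<^bsub>E\<^esub> e0" by blast
        have "s \<odot>\<^bsub>B\<^esub> u = s \<odot>\<^bsub>B\<^esub> x \<oplus>\<^bsub>B\<^esub> (s \<otimes>\<^bsub>R\<^esub> r) \<odot>\<^bsub>B\<^esub> b"
          using * b Gc that by (simp add: B.smult_r_distr B.smult_assoc1)
        moreover have "s \<odot>\<^bsub>E\<^esub> v = s \<odot>\<^bsub>E\<^esub> y \<oplus>\<^bsub>E\<^esub> (s \<otimes>\<^bsub>R\<^esub> r) \<odot>\<^bsub>E\<^esub> e0"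
          using * e0 Gc that by (simp add: E.smult_r_distr E.smult_assoc1)
        ultimately show ?thesis using HI[OF Gs[OF that(1) *(1)], of "s \<otimes>\<^bsub>R\<^esub> r"] * that by simp
      qed
      show "v = v'" if "(u,v) \<in> H" "(u,v') \<in> H" for u v v'
      proof -
        from HE[OF that(1)] HE[OF that(2)] obtain x y r x' y' r' where *:
          "(x,y) \<in> G" "r \<in> carrier R" "u = x \<oplus>\<^bsub>B\<^esub> r \<odot>\<^bsub>B\<^esub> b" "v = y \<oplus>\<^bsub>E\<^esub> r \<odot>\<^bsub>E\<^esub> e0"
          "(x',y') \<in> G" "r' \<in> carrier R" "u = x' \<oplus>\<^bsub>B\<^esub> r' \<odot>\<^bsub>B\<^esub> b" "v' = y' \<oplus>\<^bsub>E\<^esub> r' \<odot>\<^bsub>E\<^esub> e0"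
          by blast
        note c = Gc[OF *(1)] Gc[OF *(5)] *(2,6) b e0
        let ?t = "r \<oplus>\<^bsub>R\<^esub> \<ominus>\<^bsub>R\<^esub> r'"
        have t: "?t \<in> carrier R" using c by simp
        have tb: "?t \<odot>\<^bsub>B\<^esub> b = r \<odot>\<^bsub>B\<^esub> b \<oplus>\<^bsub>B\<^esub> \<ominus>\<^bsub>B\<^esub> (r' \<odot>\<^bsub>B\<^esub> b)"
          using c by (simp add: B.smult_l_distr B.smult_l_minus)
        have te: "?t \<odot>\<^bsub>E\<^esub> e0 = r \<odot>\<^bsub>E\<^esub> e0 \<oplus>\<^bsub>E\<^esub> \<ominus>\<^bsub>E\<^esub> (r' \<odot>\<^bsub>E\<^esub> e0)"
          using c by (simp add: E.smult_l_distr E.smult_l_minus)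
        have "x \<oplus>\<^bsub>B\<^esub> r \<odot>\<^bsub>B\<^esub> b = x' \<oplus>\<^bsub>B\<^esub> r' \<odot>\<^bsub>B\<^esub> b" using * by simp
        hence "r \<odot>\<^bsub>B\<^esub> b = \<ominus>\<^bsub>B\<^esub> x \<oplus>\<^bsub>B\<^esub> (x' \<oplus>\<^bsub>B\<^esub> r' \<odot>\<^bsub>B\<^esub> b)"
          using c by (metis B.M.r_neg1 B.smult_closed)
        hence "?t \<odot>\<^bsub>B\<^esub> b = (\<ominus>\<^bsub>B\<^esub> x \<oplus>\<^bsub>B\<^esub> (x' \<oplus>\<^bsub>B\<^esub> r' \<odot>\<^bsub>B\<^esub> b)) \<oplus>\<^bsub>B\<^esub> \<ominus>\<^bsub>B\<^esub> (r' \<odot>\<^bsub>B\<^esub> b)"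
          using tb by simp
        also have "\<dots> = \<ominus>\<^bsub>B\<^esub> x \<oplus>\<^bsub>B\<^esub> x'"
          using c by (simp add: B.M.a_assoc B.M.r_neg)
        also have "\<dots> = x' \<oplus>\<^bsub>B\<^esub> \<ominus>\<^bsub>B\<^esub> x"
          using c by (simp add: B.M.a_comm)
        finally have "(?t \<odot>\<^bsub>B\<^esub> b, y' \<oplus>\<^bsub>E\<^esub> \<ominus>\<^bsub>E\<^esub> y) \<in> G"
          using Ga[OF *(5) Gn[OF *(1)]] by simp
        hence "?t \<in> I" "\<phi> ?t = y' \<oplus>\<^bsub>E\<^esub> \<ominus>\<^bsub>E\<^esub> y" using t \<phi>eq by (auto simp: I_def)
        hence eq: "r \<odot>\<^bsub>E\<^esub> e0 \<oplus>\<^bsub>E\<^esub> \<ominus>\<^bsub>E\<^esub> (r' \<odot>\<^bsub>E\<^esub> e0) = y' \<oplus>\<^bsub>E\<^esub> \<ominus>\<^bsub>E\<^esub> y"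
          using h\<phi> he0[OF t] te by simp
        have "y \<oplus>\<^bsub>E\<^esub> r \<odot>\<^bsub>E\<^esub> e0 =
            y \<oplus>\<^bsub>E\<^esub> (r \<odot>\<^bsub>E\<^esub> e0 \<oplus>\<^bsub>E\<^esub> \<ominus>\<^bsub>E\<^esub> (r' \<odot>\<^bsub>E\<^esub> e0)) \<oplus>\<^bsub>E\<^esub> r' \<odot>\<^bsub>E\<^esub> e0"
          using c by (simp add: E.M.a_assoc E.M.l_neg)
        also have "\<dots> = y \<oplus>\<^bsub>E\<^esub> (y' \<oplus>\<^bsub>E\<^esub> \<ominus>\<^bsub>E\<^esub> y) \<oplus>\<^bsub>E\<^esub> r' \<odot>\<^bsub>E\<^esub> e0" by (simp only: eq)
        also have "y \<oplus>\<^bsub>E\<^esub> (y' \<oplus>\<^bsub>E\<^esub> \<ominus>\<^bsub>E\<^esub> y) = y'"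
          using c by (metis E.M.a_comm E.M.a_inv_closed E.M.add.m_closed E.M.r_neg2)
        finally show ?thesis using * by simp
      qed
    qed
    have GH: "G \<subseteq> H"
    proof (rule subrelI)
      fix x y assume "(x,y) \<in> G"
      from HI[OF this A.R.zero_closed] Gc[OF this] b e0 show "(x,y) \<in> H" by simp
    qed
    have "H = G" using Gmax[OF _ GH] linH GH G0G by (auto simp: S_def)
    moreover have "(b, e0) \<in> H" using HI[OF G_zero A.R.one_closed] b e0 by simp
    ultimately show False using nb by blast
  qed
  define h where "h x = (THE y. (x,y) \<in> G)" for x
  have heq: "h x = y" if "(x,y) \<in> G" for x y unfolding h_def using that Gf by blast
  have hG: "(x, h x) \<in> G" if "x \<in> carrier B" for x using total[OF that] heq by auto
  have "h \<in> mod_hom R B E"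
    by (rule mod_homI) (auto intro: Gc hG heq Ga Gs)
  moreover have "h (g x) = f x" if "x \<in> carrier A" for x
    using heq G0G that by (auto simp: G0_def)
  ultimately show ?thesis by blast
qed

end

theory Submission
  imports Defs
begin

text \<open>
  Let \<open>H\<close> be a submodule of the injective module \<open>M\<close> that is stable under automorphisms of \<open>M\<close>.
  If \<open>g\<close> is a square-zero endomorphism, then \<open>1 + g\<close> is an automorphism, so \<open>g\<close> preserves \<open>H\<close>.
  An endomorphism that is injective with essential image is an automorphism.

  By noetherian induction on the annihilator of \<open>x \<in> H\<close>, every endomorphism \<open>f\<close> maps \<open>x\<close> into \<open>H\<close>.
  If \<open>Rx\<close> is uniform and \<open>\<pi>\<close> projects onto an injective hull of \<open>Rx\<close>, then \<open>(1 - \<pi>) f \<pi>\<close> has square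
  zero, and \<open>\<pi> f\<close> or \<open>1 - \<pi> f\<close> is injective on the hull, hence an automorphism of it; so \<open>\<pi> f x\<close>
  and \<open>(1 - \<pi>) f x\<close> lie in \<open>H\<close>. If \<open>Rx\<close> is not uniform, it contains independent nonzero elements
  \<open>a x\<close> and \<open>b x\<close> whose annihilators are prime, and \<open>x\<close> is split into two elements of \<open>H\<close> with
  strictly larger annihilators. When the two primes agree, the projection onto a hull of \<open>R a x\<close>
  does this, since that hull also embeds into the complement. When some \<open>s\<close> lies in one prime only,
  the splitting is into the part of \<open>x\<close> killed by a power of \<open>s\<close> and the part on which \<open>s\<close> acts
  injectively.
\<close>

section \<open>Submodules and endomorphisms\<close>

context module
begin

section \<open>Submodules: closure rules, sums and cyclic submodules\<close>

lemma submodule_introI: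
  assumes "H \<subseteq> carrier M" "\<zero>\<^bsub>M\<^esub> \<in> H"
    and "\<And>x y. x \<in> H \<Longrightarrow> y \<in> H \<Longrightarrow> x \<oplus>\<^bsub>M\<^esub> y \<in> H"
    and smul: "\<And>r x. r \<in> carrier R \<Longrightarrow> x \<in> H \<Longrightarrow> r \<odot>\<^bsub>M\<^esub> x \<in> H"
  shows "submodule H R M"
proof (rule submoduleI)
  show "\<ominus>\<^bsub>M\<^esub> x \<in> H" if "x \<in> H" for x
    using smul[of "\<ominus>\<^bsub>R\<^esub> \<one>\<^bsub>R\<^esub>" x] that assms(1) by (auto simp: smult_l_minus)
qed (use assms in auto)

lemma submoduleD:
  assumes "submodule H R M"
  shows "\<And>x. x \<in> H \<Longrightarrow> x \<in> carrier M" and "\<zero>\<^bsub>M\<^esub> \<in> H"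
    and "\<And>x y. x \<in> H \<Longrightarrow> y \<in> H \<Longrightarrow> x \<oplus>\<^bsub>M\<^esub> y \<in> H"
    and "\<And>x y. x \<in> H \<Longrightarrow> y \<in> H \<Longrightarrow> x \<ominus>\<^bsub>M\<^esub> y \<in> H"
    and "\<And>r x. r \<in> carrier R \<Longrightarrow> x \<in> H \<Longrightarrow> r \<odot>\<^bsub>M\<^esub> x \<in> H"
    and "\<And>x. x \<in> H \<Longrightarrow> \<ominus>\<^bsub>M\<^esub> x \<in> H"
proof -
  note E = submoduleE[OF assms]
  show "\<zero>\<^bsub>M\<^esub> \<in> H" using E(1,2) E(4)[OF R.zero_closed] by (metis equals0I smult_l_null subsetD)
qed (use submoduleE[OF assms] in \<open>auto simp: a_minus_def\<close>)

lemma submodule_sum: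
  assumes A: "submodule A R M" and B: "submodule B R M"
  shows "submodule {a \<oplus>\<^bsub>M\<^esub> b |a b. a \<in> A \<and> b \<in> B} R M" (is "submodule ?S R M")
proof (rule submodule_introI)
  note a = submoduleD[OF A] and b = submoduleD[OF B]
  show "?S \<subseteq> carrier M" using a(1) b(1) by auto
  show "\<zero>\<^bsub>M\<^esub> \<in> ?S" using a(2) b(2) by force
  fix x y assume "x \<in> ?S" "y \<in> ?S"
  then obtain p q p' q' where "p \<in> A" "q \<in> B" "p' \<in> A" "q' \<in> B" "x = p \<oplus>\<^bsub>M\<^esub> q" "y = p' \<oplus>\<^bsub>M\<^esub> q'" by blast
  moreover from this have "x \<oplus>\<^bsub>M\<^esub> y = (p \<oplus>\<^bsub>M\<^esub> p') \<oplus>\<^bsub>M\<^esub> (q \<oplus>\<^bsub>M\<^esub> q')"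
    by (simp add: a(1) b(1) M.a_ac)
  ultimately show "x \<oplus>\<^bsub>M\<^esub> y \<in> ?S" using a(3) b(3) by blast
next
  note a = submoduleD[OF A] and b = submoduleD[OF B]
  fix r x assume r: "r \<in> carrier R" and "x \<in> ?S"
  then obtain p q where "p \<in> A" "q \<in> B" "x = p \<oplus>\<^bsub>M\<^esub> q" by blast
  moreover from this r have "r \<odot>\<^bsub>M\<^esub> x = r \<odot>\<^bsub>M\<^esub> p \<oplus>\<^bsub>M\<^esub> r \<odot>\<^bsub>M\<^esub> q"
    by (simp add: a(1) b(1) smult_r_distr)
  ultimately show "r \<odot>\<^bsub>M\<^esub> x \<in> ?S" using r a(5) b(5) by blast
qed

lemma submodule_sum_upper:
  assumes A: "submodule A R M" and B: "submodule B R M"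
  shows "A \<subseteq> {a \<oplus>\<^bsub>M\<^esub> b |a b. a \<in> A \<and> b \<in> B}" "B \<subseteq> {a \<oplus>\<^bsub>M\<^esub> b |a b. a \<in> A \<and> b \<in> B}"
proof -
  note a = submoduleD[OF A] and b = submoduleD[OF B]
  have "x = x \<oplus>\<^bsub>M\<^esub> \<zero>\<^bsub>M\<^esub>" if "x \<in> A" for x using a(1)[OF that] by simp
  thus "A \<subseteq> {a \<oplus>\<^bsub>M\<^esub> b |a b. a \<in> A \<and> b \<in> B}" using b(2) by blast
  have "x = \<zero>\<^bsub>M\<^esub> \<oplus>\<^bsub>M\<^esub> x" if "x \<in> B" for x using b(1)[OF that] by simp
  thus "B \<subseteq> {a \<oplus>\<^bsub>M\<^esub> b |a b. a \<in> A \<and> b \<in> B}" using a(2) by blast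
qed

lemma cyclic_submodule:
  assumes x: "x \<in> carrier M"
  shows "submodule {r \<odot>\<^bsub>M\<^esub> x |r. r \<in> carrier R} R M" (is "submodule ?S R M")
proof (rule submodule_introI)
  show "?S \<subseteq> carrier M" using x by auto
  show "\<zero>\<^bsub>M\<^esub> \<in> ?S" using smult_l_null[OF x] by force
  show "u \<oplus>\<^bsub>M\<^esub> v \<in> ?S" if "u \<in> ?S" "v \<in> ?S" for u v
  proof -
    from that obtain r s where "r \<in> carrier R" "s \<in> carrier R" "u = r \<odot>\<^bsub>M\<^esub> x" "v = s \<odot>\<^bsub>M\<^esub> x" by blast
    thus ?thesis using x smult_l_distr[of r s x] by (metis (mono_tags, lifting) R.a_closed mem_Collect_eq)
  qed
  show "r \<odot>\<^bsub>M\<^esub> u \<in> ?S" if r: "r \<in> carrier R" and "u \<in> ?S" for r u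
  proof -
    from that obtain s where "s \<in> carrier R" "u = s \<odot>\<^bsub>M\<^esub> x" by blast
    thus ?thesis using x r smult_assoc1[of r s x] by (metis (mono_tags, lifting) R.m_closed mem_Collect_eq)
  qed
qed

lemma mem_cyclic: "x \<in> carrier M \<Longrightarrow> x \<in> {r \<odot>\<^bsub>M\<^esub> x |r. r \<in> carrier R}"
  using smult_one[of x] R.one_closed by force

text \<open>Commutativity of \<open>R\<close> in module form. Through it, multiplication by a scalar
  is an endomorphism, and annihilators can only grow when an element is multiplied by a
  scalar.\<close>

lemma smult_comm:
  "r \<in> carrier R \<Longrightarrow> s \<in> carrier R \<Longrightarrow> x \<in> carrier M \<Longrightarrow> r \<odot>\<^bsub>M\<^esub> (s \<odot>\<^bsub>M\<^esub> x) = s \<odot>\<^bsub>M\<^esub> (r \<odot>\<^bsub>M\<^esub> x)"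
  using smult_assoc1[of r s x] smult_assoc1[of s r x] R.m_comm[of r s] by simp

lemma smult_r_diff:
  "r \<in> carrier R \<Longrightarrow> x \<in> carrier M \<Longrightarrow> y \<in> carrier M \<Longrightarrow> r \<odot>\<^bsub>M\<^esub> (x \<ominus>\<^bsub>M\<^esub> y) = r \<odot>\<^bsub>M\<^esub> x \<ominus>\<^bsub>M\<^esub> r \<odot>\<^bsub>M\<^esub> y"
  by (simp add: a_minus_def smult_r_distr smult_r_minus)

lemma diff_eq_zero_iff:
  "x \<in> carrier M \<Longrightarrow> y \<in> carrier M \<Longrightarrow> x \<ominus>\<^bsub>M\<^esub> y = \<zero>\<^bsub>M\<^esub> \<longleftrightarrow> x = y"
  by (metis M.add.inv_closed M.add.m_closed M.add.r_cancel_one' M.l_neg M.r_neg M.add.right_cancel a_minus_def)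

lemma add_diff_cancel:
  "x \<in> carrier M \<Longrightarrow> y \<in> carrier M \<Longrightarrow> x \<oplus>\<^bsub>M\<^esub> (y \<ominus>\<^bsub>M\<^esub> x) = y"
  "x \<in> carrier M \<Longrightarrow> y \<in> carrier M \<Longrightarrow> (x \<oplus>\<^bsub>M\<^esub> y) \<ominus>\<^bsub>M\<^esub> x = y"
  "x \<in> carrier M \<Longrightarrow> y \<in> carrier M \<Longrightarrow> (y \<ominus>\<^bsub>M\<^esub> x) \<oplus>\<^bsub>M\<^esub> x = y"
proof -
  show *: "x \<in> carrier M \<Longrightarrow> y \<in> carrier M \<Longrightarrow> x \<oplus>\<^bsub>M\<^esub> (y \<ominus>\<^bsub>M\<^esub> x) = y"
    by (simp add: a_minus_def M.a_lcomm[of x y] M.r_neg)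
  show "x \<in> carrier M \<Longrightarrow> y \<in> carrier M \<Longrightarrow> (x \<oplus>\<^bsub>M\<^esub> y) \<ominus>\<^bsub>M\<^esub> x = y"
    using * by (simp add: a_minus_def M.a_assoc)
  show "x \<in> carrier M \<Longrightarrow> y \<in> carrier M \<Longrightarrow> (y \<ominus>\<^bsub>M\<^esub> x) \<oplus>\<^bsub>M\<^esub> x = y"
    by (simp add: a_minus_def M.a_assoc M.l_neg)
qed

lemma diff_self: "x \<in> carrier M \<Longrightarrow> x \<ominus>\<^bsub>M\<^esub> x = \<zero>\<^bsub>M\<^esub>"
  by (simp add: diff_eq_zero_iff)

lemma diff_zero: "x \<in> carrier M \<Longrightarrow> x \<ominus>\<^bsub>M\<^esub> \<zero>\<^bsub>M\<^esub> = x"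
  using add_diff_cancel(1)[of "\<zero>\<^bsub>M\<^esub>" x] by simp

section \<open>Operations on endomorphisms, kernels, images and inverses of automorphisms\<close>

lemma mod_endI:
  assumes "\<And>x. x \<in> carrier M \<Longrightarrow> f x \<in> carrier M"
    and "\<And>x y. x \<in> carrier M \<Longrightarrow> y \<in> carrier M \<Longrightarrow> f (x \<oplus>\<^bsub>M\<^esub> y) = f x \<oplus>\<^bsub>M\<^esub> f y"
    and "\<And>r x. r \<in> carrier R \<Longrightarrow> x \<in> carrier M \<Longrightarrow> f (r \<odot>\<^bsub>M\<^esub> x) = r \<odot>\<^bsub>M\<^esub> f x"
  shows "f \<in> mod_end R M"
  unfolding mod_end_def using assms by (rule mod_homI)

lemma mod_endD:
  assumes "f \<in> mod_end R M"
  shows "\<And>x. x \<in> carrier M \<Longrightarrow> f x \<in> carrier M"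
    and "\<And>x y. x \<in> carrier M \<Longrightarrow> y \<in> carrier M \<Longrightarrow> f (x \<oplus>\<^bsub>M\<^esub> y) = f x \<oplus>\<^bsub>M\<^esub> f y"
    and "\<And>r x. r \<in> carrier R \<Longrightarrow> x \<in> carrier M \<Longrightarrow> f (r \<odot>\<^bsub>M\<^esub> x) = r \<odot>\<^bsub>M\<^esub> f x"
    and "f \<zero>\<^bsub>M\<^esub> = \<zero>\<^bsub>M\<^esub>"
    and "\<And>x. x \<in> carrier M \<Longrightarrow> f (\<ominus>\<^bsub>M\<^esub> x) = \<ominus>\<^bsub>M\<^esub> f x"
    and "\<And>x y. x \<in> carrier M \<Longrightarrow> y \<in> carrier M \<Longrightarrow> f (x \<ominus>\<^bsub>M\<^esub> y) = f x \<ominus>\<^bsub>M\<^esub> f y"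
proof -
  note D = mod_homD[OF assms[unfolded mod_end_def]]
  show closed: "f x \<in> carrier M" if "x \<in> carrier M" for x using D(1) that .
  show add: "f (x \<oplus>\<^bsub>M\<^esub> y) = f x \<oplus>\<^bsub>M\<^esub> f y" if "x \<in> carrier M" "y \<in> carrier M" for x y
    using D(2) that .
  show smul: "f (r \<odot>\<^bsub>M\<^esub> x) = r \<odot>\<^bsub>M\<^esub> f x" if "r \<in> carrier R" "x \<in> carrier M" for r x
    using D(3) that .
  show "f \<zero>\<^bsub>M\<^esub> = \<zero>\<^bsub>M\<^esub>"
    using smul[OF R.zero_closed M.zero_closed] closed by simp
  show neg: "f (\<ominus>\<^bsub>M\<^esub> x) = \<ominus>\<^bsub>M\<^esub> f x" if "x \<in> carrier M" for x
    using smul[of "\<ominus>\<^bsub>R\<^esub> \<one>\<^bsub>R\<^esub>" x] that closed by (simp add: smult_l_minus)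
  show "f (x \<ominus>\<^bsub>M\<^esub> y) = f x \<ominus>\<^bsub>M\<^esub> f y" if "x \<in> carrier M" "y \<in> carrier M" for x y
    using that by (simp add: a_minus_def add neg)
qed

lemma mod_end_compose:
  assumes "f \<in> mod_end R M" "g \<in> mod_end R M"
  shows "(\<lambda>x. f (g x)) \<in> mod_end R M"
  by (rule mod_endI) (simp_all add: mod_endD[OF assms(1)] mod_endD[OF assms(2)])

lemma mod_end_add:
  assumes "f \<in> mod_end R M" "g \<in> mod_end R M"
  shows "(\<lambda>x. f x \<oplus>\<^bsub>M\<^esub> g x) \<in> mod_end R M"
  by (rule mod_endI)
    (simp_all add: mod_endD[OF assms(1)] mod_endD[OF assms(2)] M.a_ac smult_r_distr)

lemma mod_end_diff:
  assumes "f \<in> mod_end R M" "g \<in> mod_end R M"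
  shows "(\<lambda>x. f x \<ominus>\<^bsub>M\<^esub> g x) \<in> mod_end R M"
  by (rule mod_endI)
    (simp_all add: mod_endD[OF assms(1)] mod_endD[OF assms(2)] a_minus_def M.minus_add M.a_ac
      smult_r_distr smult_r_minus)

lemma mod_end_id: "(\<lambda>x. x) \<in> mod_end R M"
  by (rule mod_endI) auto

lemma mod_end_smult:
  assumes "r \<in> carrier R"
  shows "(\<lambda>x. r \<odot>\<^bsub>M\<^esub> x) \<in> mod_end R M"
  by (rule mod_endI) (use assms in \<open>auto simp: smult_r_distr smult_comm\<close>)

lemma mod_end_kernel:
  assumes "f \<in> mod_end R M"
  shows "submodule {x \<in> carrier M. f x = \<zero>\<^bsub>M\<^esub>} R M"
  by (rule submodule_introI) (auto simp: mod_endD[OF assms])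

lemma mod_end_image:
  assumes f: "f \<in> mod_end R M"
  shows "submodule (f ` carrier M) R M"
proof (rule submodule_introI)
  note D = mod_endD[OF f]
  show "f ` carrier M \<subseteq> carrier M" using D(1) by auto
  show "\<zero>\<^bsub>M\<^esub> \<in> f ` carrier M" using D(4) by (metis M.zero_closed imageI)
  show "x \<oplus>\<^bsub>M\<^esub> y \<in> f ` carrier M" if "x \<in> f ` carrier M" "y \<in> f ` carrier M" for x y
    using that by (auto simp flip: D(2))
  show "r \<odot>\<^bsub>M\<^esub> x \<in> f ` carrier M" if "r \<in> carrier R" "x \<in> f ` carrier M" for r x
    using that by (auto simp flip: D(3))
qed

lemma mod_aut_inv:
  assumes f: "f \<in> mod_aut R M"
  shows "inv_into (carrier M) f \<in> mod_aut R M"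
proof -
  have e: "f \<in> mod_end R M" and bij: "bij_betw f (carrier M) (carrier M)"
    using f by (auto simp: mod_aut_def)
  note D = mod_endD[OF e]
  let ?g = "inv_into (carrier M) f"
  have gb: "bij_betw ?g (carrier M) (carrier M)" by (rule bij_betw_inv_into[OF bij])
  have gc: "?g x \<in> carrier M" if "x \<in> carrier M" for x
    using gb that by (rule bij_betwE[THEN bspec])
  have fg: "f (?g x) = x" if "x \<in> carrier M" for x
    using bij that by (rule bij_betw_inv_into_right)
  have gf: "?g (f x) = x" if "x \<in> carrier M" for x
    using bij that by (rule bij_betw_inv_into_left)
  have "?g \<in> mod_end R M"
  proof (rule mod_endI)
    show "?g (x \<oplus>\<^bsub>M\<^esub> y) = ?g x \<oplus>\<^bsub>M\<^esub> ?g y" if "x \<in> carrier M" "y \<in> carrier M" for x y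
      using gf[of "?g x \<oplus>\<^bsub>M\<^esub> ?g y"] that by (simp add: D gc fg)
    show "?g (r \<odot>\<^bsub>M\<^esub> x) = r \<odot>\<^bsub>M\<^esub> ?g x" if "r \<in> carrier R" "x \<in> carrier M" for r x
      using gf[of "r \<odot>\<^bsub>M\<^esub> ?g x"] that by (simp add: D gc fg)
  qed (rule gc)
  thus ?thesis using gb by (simp add: mod_aut_def)
qed

text \<open>Zorn's lemma yields \<open>C\<close>, because the union of a nonempty chain of
  submodules that contain \<open>K\<close> and avoid \<open>N\<close> is again one. Requiring
  \<open>K\<close> below \<open>C\<close> allows a projection onto a hull of \<open>N\<close> to be
  prescribed as zero on \<open>K\<close>.\<close>

lemma complement_above:
  assumes N: "submodule N R M" and K: "submodule K R M" and NK: "N \<inter> K \<subseteq> {\<zero>\<^bsub>M\<^esub>}"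
  obtains C where "submodule C R M" "K \<subseteq> C" "N \<inter> C \<subseteq> {\<zero>\<^bsub>M\<^esub>}"
    "\<And>D. submodule D R M \<Longrightarrow> C \<subseteq> D \<Longrightarrow> N \<inter> D \<subseteq> {\<zero>\<^bsub>M\<^esub>} \<Longrightarrow> D = C"
proof -
  define S where "S = {C. submodule C R M \<and> K \<subseteq> C \<and> N \<inter> C \<subseteq> {\<zero>\<^bsub>M\<^esub>}}"
  have "S \<noteq> {}" using K NK by (auto simp: S_def)
  moreover have "\<Union>F \<in> S" if F: "F \<noteq> {}" "subset.chain S F" for F
  proof -
    have mem: "submodule C R M" "K \<subseteq> C" "N \<inter> C \<subseteq> {\<zero>\<^bsub>M\<^esub>}" if "C \<in> F" for C
      using that F by (auto simp: subset_chain_def S_def)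
    have two: "\<exists>C\<in>F. x \<in> C \<and> y \<in> C" if "x \<in> \<Union>F" "y \<in> \<Union>F" for x y
      using that F(2) unfolding subset_chain_def by (meson UnionE subsetD)
    have "submodule (\<Union>F) R M"
    proof (rule submodule_introI)
      show "\<Union>F \<subseteq> carrier M" using submoduleD(1) mem(1) by blast
      show "\<zero>\<^bsub>M\<^esub> \<in> \<Union>F" using submoduleD(2) mem(1) F(1) by blast
      show "x \<oplus>\<^bsub>M\<^esub> y \<in> \<Union>F" if "x \<in> \<Union>F" "y \<in> \<Union>F" for x y
        using two[OF that] submoduleD(3) mem(1) by blast
      show "r \<odot>\<^bsub>M\<^esub> x \<in> \<Union>F" if "r \<in> carrier R" "x \<in> \<Union>F" for r x
        using that submoduleD(5) mem(1) by blast
    qed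
    moreover have "K \<subseteq> \<Union>F" using mem(2) F(1) by blast
    moreover have "N \<inter> \<Union>F \<subseteq> {\<zero>\<^bsub>M\<^esub>}" using mem(3) by blast
    ultimately show ?thesis by (simp add: S_def)
  qed
  ultimately obtain C where C: "C \<in> S" and max: "\<And>D. D \<in> S \<Longrightarrow> C \<subseteq> D \<Longrightarrow> D = C"
    using subset_Zorn_nonempty[of S] by blast
  show thesis
  proof (rule that[of C])
    show "D = C" if "submodule D R M" "C \<subseteq> D" "N \<inter> D \<subseteq> {\<zero>\<^bsub>M\<^esub>}" for D
      using max[of D] C that by (auto simp: S_def)
  qed (use C in \<open>auto simp: S_def\<close>)
qed

section \<open>Annihilators and the noetherian condition\<close>

definition ann :: "'c \<Rightarrow> 'a set"
  where "ann x = {r \<in> carrier R. r \<odot>\<^bsub>M\<^esub> x = \<zero>\<^bsub>M\<^esub>}"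

lemma ann_ideal:
  assumes x: "x \<in> carrier M"
  shows "ideal (ann x) R"
proof (rule idealI)
  show "subgroup (ann x) (add_monoid R)"
  proof (rule R.add.subgroupI)
    show "ann x \<noteq> {}" using x by (auto simp: ann_def intro: exI[of _ "\<zero>\<^bsub>R\<^esub>"])
  qed (use x in \<open>auto simp: ann_def smult_l_distr smult_l_minus simp flip: a_inv_def\<close>)
  show "s \<otimes>\<^bsub>R\<^esub> r \<in> ann x" if "r \<in> ann x" "s \<in> carrier R" for r s
    using that x by (auto simp: ann_def smult_assoc1)
  thus "r \<otimes>\<^bsub>R\<^esub> s \<in> ann x" if "r \<in> ann x" "s \<in> carrier R" for r s
    using that by (metis (no_types, lifting) R.m_comm ann_def mem_Collect_eq)
qed (rule R.ring_axioms)

lemma ann_smult_mono: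
  "x \<in> carrier M \<Longrightarrow> r \<in> carrier R \<Longrightarrow> ann x \<subseteq> ann (r \<odot>\<^bsub>M\<^esub> x)"
  by (auto simp: ann_def smult_comm[of _ r])

end

text \<open>In a noetherian ring a nonempty chain of ideals has its union as a member, so Zorn's
  lemma applies. This is the form in which the noetherian hypothesis is used later.\<close>

lemma (in noetherian_ring) ideal_family_maximal:
  assumes "F \<noteq> {}" "\<And>I. I \<in> F \<Longrightarrow> ideal I R"
  shows "\<exists>I\<in>F. \<forall>J\<in>F. I \<subseteq> J \<longrightarrow> J = I"
proof -
  have "\<Union>C \<in> F" if "C \<noteq> {}" "subset.chain F C" for C
  proof -
    have CF: "C \<subseteq> F" using that(2) by (simp add: subset_chain_def)
    have "subset.chain {I. ideal I R} C"
      using that(2) assms(2) unfolding subset_chain_def by blast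
    from ideal_chain_is_trivial[OF that(1) this] CF show ?thesis by (rule subsetD[rotated])
  qed
  thus ?thesis by (rule subset_Zorn_nonempty[OF assms(1)])
qed

section \<open>Extending maps into an injective module\<close>

text \<open>From here on \<open>M\<close> is an injective module; the theorem instantiates it with
  the envelope \<open>E\<close>, and the original module reappears as the stable submodule
  \<open>H\<close>.\<close>

locale injective_mod = module +
  assumes injective: "injective_module R M"
begin

text \<open>\<open>G\<close> is the graph of a homomorphism given on a submodule only. By linearity,
  two values at one point differ by a value at zero, so uniqueness at zero makes \<open>G\<close> a
  function; injectivity then extends it from its domain to \<open>M\<close>.\<close>

lemma linear_relation_extends:
  assumes G: "G \<subseteq> carrier M \<times> carrier M" "(\<zero>\<^bsub>M\<^esub>, \<zero>\<^bsub>M\<^esub>) \<in> G"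
    and add: "\<And>x y x' y'. (x, y) \<in> G \<Longrightarrow> (x', y') \<in> G \<Longrightarrow> (x \<oplus>\<^bsub>M\<^esub> x', y \<oplus>\<^bsub>M\<^esub> y') \<in> G"
    and smul: "\<And>r x y. r \<in> carrier R \<Longrightarrow> (x, y) \<in> G \<Longrightarrow> (r \<odot>\<^bsub>M\<^esub> x, r \<odot>\<^bsub>M\<^esub> y) \<in> G"
    and single: "\<And>y. (\<zero>\<^bsub>M\<^esub>, y) \<in> G \<Longrightarrow> y = \<zero>\<^bsub>M\<^esub>"
  obtains h where "h \<in> mod_end R M" "\<And>x y. (x, y) \<in> G \<Longrightarrow> h x = y"
proof -
  have c: "x \<in> carrier M" "y \<in> carrier M" if "(x, y) \<in> G" for x y using that G by auto
  have functional: "y = y'" if "(x, y) \<in> G" "(x, y') \<in> G" for x y y'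
  proof -
    have "(\<ominus>\<^bsub>M\<^esub> x, \<ominus>\<^bsub>M\<^esub> y') \<in> G"
      using smul[of "\<ominus>\<^bsub>R\<^esub> \<one>\<^bsub>R\<^esub>" x y'] that c by (simp add: smult_l_minus)
    from add[OF that(1) this] have "(\<zero>\<^bsub>M\<^esub>, y \<ominus>\<^bsub>M\<^esub> y') \<in> G"
      using c that by (simp add: a_minus_def M.r_neg)
    thus ?thesis using single diff_eq_zero_iff c that by blast
  qed
  define f where "f x = (THE y. (x, y) \<in> G)" for x
  have f: "f x = y" if "(x, y) \<in> G" for x y
    unfolding f_def using that functional by blast
  let ?N = "M\<lparr>carrier := Domain G\<rparr>"
  have sub: "submodule (Domain G) R M"
    by (rule submodule_introI) (use G add smul in blast)+
  have "module R ?N" by (rule submodule.submodule_is_module[OF sub]) unfold_locales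
  moreover have "module R M" by unfold_locales
  moreover have "(\<lambda>x. x) \<in> mod_hom R ?N M" by (rule mod_homI) (auto dest: c)
  moreover have "f \<in> mod_hom R ?N M"
  proof (rule mod_homI)
    show "f x \<in> carrier M" if "x \<in> carrier ?N" for x using that f c by auto
    show "f (x \<oplus>\<^bsub>?N\<^esub> y) = f x \<oplus>\<^bsub>M\<^esub> f y" if "x \<in> carrier ?N" "y \<in> carrier ?N" for x y
      using that by (auto simp: f intro!: f add)
    show "f (r \<odot>\<^bsub>?N\<^esub> x) = r \<odot>\<^bsub>M\<^esub> f x" if "r \<in> carrier R" "x \<in> carrier ?N" for r x
      using that by (auto simp: f intro!: f smul)
  qed
  ultimately obtain h where h: "h \<in> mod_hom R M M" "\<forall>x\<in>carrier ?N. h x = f x"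
    using injective_module_extend[OF injective, of ?N M "\<lambda>x. x" f] by auto
  show thesis
  proof (rule that[of h])
    show "h \<in> mod_end R M" using h(1) by (simp add: mod_end_def)
    show "h x = y" if "(x, y) \<in> G" for x y using h(2) f[OF that] that by auto
  qed
qed

text \<open>Take \<open>C\<close> maximal above \<open>K\<close> avoiding \<open>N\<close>, then
  \<open>D\<close> maximal above \<open>N\<close> avoiding \<open>C\<close>. The map
  \<open>d + c \<mapsto> d\<close> extends to an endomorphism \<open>\<pi>\<close>, and maximality
  of \<open>D\<close> makes its image exactly \<open>D\<close>, which gives idempotence. The image
  is thus an injective hull of \<open>N\<close>.\<close>

lemma submodule_projection:
  assumes N: "submodule N R M" and K: "submodule K R M" and NK: "N \<inter> K \<subseteq> {\<zero>\<^bsub>M\<^esub>}"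
  obtains \<pi> where
    \<comment> \<open>The last clause says that \<open>N\<close> is essential in the image of \<open>\<pi>\<close>.\<close>
    "\<pi> \<in> mod_end R M" "\<And>x. x \<in> carrier M \<Longrightarrow> \<pi> (\<pi> x) = \<pi> x"
    "\<And>x. x \<in> N \<Longrightarrow> \<pi> x = x" "\<And>x. x \<in> K \<Longrightarrow> \<pi> x = \<zero>\<^bsub>M\<^esub>"
    "\<And>x. x \<in> carrier M \<Longrightarrow> \<pi> x \<noteq> \<zero>\<^bsub>M\<^esub> \<Longrightarrow> \<exists>r\<in>carrier R. r \<odot>\<^bsub>M\<^esub> \<pi> x \<in> N \<and> r \<odot>\<^bsub>M\<^esub> \<pi> x \<noteq> \<zero>\<^bsub>M\<^esub>"
proof -
  obtain C where C: "submodule C R M" and KC: "K \<subseteq> C" and NC: "N \<inter> C \<subseteq> {\<zero>\<^bsub>M\<^esub>}"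
    and maxC: "\<And>D. submodule D R M \<Longrightarrow> C \<subseteq> D \<Longrightarrow> N \<inter> D \<subseteq> {\<zero>\<^bsub>M\<^esub>} \<Longrightarrow> D = C"
    using complement_above[OF N K NK] by blast
  obtain D where D: "submodule D R M" and ND: "N \<subseteq> D" and CD: "C \<inter> D \<subseteq> {\<zero>\<^bsub>M\<^esub>}"
    and maxD: "\<And>D'. submodule D' R M \<Longrightarrow> D \<subseteq> D' \<Longrightarrow> C \<inter> D' \<subseteq> {\<zero>\<^bsub>M\<^esub>} \<Longrightarrow> D' = D"
    using complement_above[OF C N] NC by (metis inf_commute)
  note c = submoduleD[OF C] and d = submoduleD[OF D]
  define G where "G = {(x \<oplus>\<^bsub>M\<^esub> y, x) |x y. x \<in> D \<and> y \<in> C}"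
  have GI: "(x \<oplus>\<^bsub>M\<^esub> y, x) \<in> G" if "x \<in> D" "y \<in> C" for x y using that by (auto simp: G_def)
  obtain \<pi> where \<pi>: "\<pi> \<in> mod_end R M" and \<pi>G: "\<And>x y. (x, y) \<in> G \<Longrightarrow> \<pi> x = y"
  proof (rule linear_relation_extends[of G])
    show "G \<subseteq> carrier M \<times> carrier M" using c(1) d(1) by (auto simp: G_def)
    show "(\<zero>\<^bsub>M\<^esub>, \<zero>\<^bsub>M\<^esub>) \<in> G" using GI[OF d(2) c(2)] by simp
    show "(x \<oplus>\<^bsub>M\<^esub> x', y \<oplus>\<^bsub>M\<^esub> y') \<in> G" if "(x, y) \<in> G" "(x', y') \<in> G" for x y x' y'
    proof -
      from that obtain z z' where z: "z \<in> C" "z' \<in> C" "y \<in> D" "y' \<in> D" "x = y \<oplus>\<^bsub>M\<^esub> z" "x' = y' \<oplus>\<^bsub>M\<^esub> z'"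
        by (auto simp: G_def)
      hence "x \<oplus>\<^bsub>M\<^esub> x' = (y \<oplus>\<^bsub>M\<^esub> y') \<oplus>\<^bsub>M\<^esub> (z \<oplus>\<^bsub>M\<^esub> z')" by (simp add: c(1) d(1) M.a_ac)
      thus ?thesis using GI[OF d(3) c(3)] z by metis
    qed
    show "(r \<odot>\<^bsub>M\<^esub> x, r \<odot>\<^bsub>M\<^esub> y) \<in> G" if r: "r \<in> carrier R" and "(x, y) \<in> G" for r x y
    proof -
      from that obtain z where z: "z \<in> C" "y \<in> D" "x = y \<oplus>\<^bsub>M\<^esub> z" by (auto simp: G_def)
      hence "r \<odot>\<^bsub>M\<^esub> x = r \<odot>\<^bsub>M\<^esub> y \<oplus>\<^bsub>M\<^esub> r \<odot>\<^bsub>M\<^esub> z" by (simp add: r c(1) d(1) smult_r_distr)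
      thus ?thesis using GI[OF d(5) c(5)] z r by metis
    qed
    show "y = \<zero>\<^bsub>M\<^esub>" if "(\<zero>\<^bsub>M\<^esub>, y) \<in> G" for y
    proof -
      from that obtain z where z: "z \<in> C" "y \<in> D" "y \<oplus>\<^bsub>M\<^esub> z = \<zero>\<^bsub>M\<^esub>" by (auto simp: G_def)
      hence "y = \<ominus>\<^bsub>M\<^esub> z" using c(1) d(1) by (metis M.minus_equality)
      thus ?thesis using z c(6) CD by blast
    qed
  qed blast
  note p = mod_endD[OF \<pi>]
  have \<pi>D: "\<pi> x = x" if "x \<in> D" for x using \<pi>G[OF GI[OF that c(2)]] d(1)[OF that] by simp
  have \<pi>C: "\<pi> x = \<zero>\<^bsub>M\<^esub>" if "x \<in> C" for x using \<pi>G[OF GI[OF d(2) that]] c(1)[OF that] by simp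
  have ker: "{x \<in> carrier M. \<pi> x = \<zero>\<^bsub>M\<^esub>} = C"
  proof (rule maxC[OF mod_end_kernel[OF \<pi>]])
    show "C \<subseteq> {x \<in> carrier M. \<pi> x = \<zero>\<^bsub>M\<^esub>}" using \<pi>C c(1) by blast
    show "N \<inter> {x \<in> carrier M. \<pi> x = \<zero>\<^bsub>M\<^esub>} \<subseteq> {\<zero>\<^bsub>M\<^esub>}" using \<pi>D ND by auto
  qed
  have ess: "\<exists>r\<in>carrier R. r \<odot>\<^bsub>M\<^esub> \<pi> x \<in> N \<and> r \<odot>\<^bsub>M\<^esub> \<pi> x \<noteq> \<zero>\<^bsub>M\<^esub>"
    if x: "x \<in> carrier M" and nz: "\<pi> x \<noteq> \<zero>\<^bsub>M\<^esub>" for x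
  proof (rule ccontr)
    assume neg: "\<not> ?thesis"
    \<comment> \<open>Adding \<open>R x\<close> to \<open>C\<close> still avoids \<open>N\<close>:
      an element \<open>y + r x\<close> of \<open>N\<close> is fixed by \<open>\<pi>\<close>, hence
      equals \<open>r \<pi> x\<close>, which is zero by assumption. Maximality of \<open>C\<close>
      then puts \<open>x\<close> into \<open>C\<close>, where \<open>\<pi>\<close> vanishes.\<close>
    let ?D = "{y \<oplus>\<^bsub>M\<^esub> z |y z. y \<in> C \<and> z \<in> {r \<odot>\<^bsub>M\<^esub> x |r. r \<in> carrier R}}"
    have sub: "submodule ?D R M" by (rule submodule_sum[OF C cyclic_submodule[OF x]])
    have "?D = C"
    proof (rule maxC[OF sub])
      show "C \<subseteq> ?D" by (rule submodule_sum_upper(1)[OF C cyclic_submodule[OF x]])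
      show "N \<inter> ?D \<subseteq> {\<zero>\<^bsub>M\<^esub>}"
      proof
        fix n assume n: "n \<in> N \<inter> ?D"
        then obtain y r where y: "y \<in> C" "r \<in> carrier R" "n = y \<oplus>\<^bsub>M\<^esub> r \<odot>\<^bsub>M\<^esub> x" by blast
        have "n = \<pi> n" using n ND \<pi>D by auto
        also have "\<dots> = r \<odot>\<^bsub>M\<^esub> \<pi> x" using y x c(1) by (simp add: p \<pi>C)
        finally show "n \<in> {\<zero>\<^bsub>M\<^esub>}" using neg n y(2) by auto
      qed
    qed
    moreover have "x \<in> ?D" 
      using submodule_sum_upper(2)[OF C cyclic_submodule[OF x]] mem_cyclic[OF x] by (rule subsetD)
    ultimately show False using \<pi>C nz by blast
  qed
  have im: "\<pi> ` carrier M = D"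
  proof (rule maxD[OF mod_end_image[OF \<pi>]])
    show "D \<subseteq> \<pi> ` carrier M" using \<pi>D d(1) by (metis imageI subsetI)
    \<comment> \<open>A nonzero element of \<open>C\<close> in the image would have a nonzero
      multiple in \<open>N\<close>, and that multiple would also lie in \<open>C\<close>.\<close>
    show "C \<inter> \<pi> ` carrier M \<subseteq> {\<zero>\<^bsub>M\<^esub>}" using ess c(5) NC by blast
  qed
  show thesis
  proof (rule that[OF \<pi>])
    show "\<pi> (\<pi> x) = \<pi> x" if "x \<in> carrier M" for x using \<pi>D im that by blast
  qed (use \<pi>D ND \<pi>C KC ess in blast)+
qed

text \<open>Injectivity of \<open>M\<close> extends the inverse of \<open>h\<close> on its image to
  an endomorphism \<open>k\<close> with \<open>k h = 1\<close>. A nonzero element of the kernel of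
  \<open>k\<close> would have a nonzero multiple in the image of \<open>h\<close>, where
  \<open>k\<close> is injective; so \<open>k\<close> is injective, and
  \<open>k (h k x - x) = 0\<close> gives \<open>h k = 1\<close>.\<close>

lemma essential_mono_aut:
  assumes h: "h \<in> mod_end R M"
    and inj: "\<And>x. x \<in> carrier M \<Longrightarrow> h x = \<zero>\<^bsub>M\<^esub> \<Longrightarrow> x = \<zero>\<^bsub>M\<^esub>"
    and ess: "\<And>x. x \<in> carrier M \<Longrightarrow> x \<noteq> \<zero>\<^bsub>M\<^esub> \<Longrightarrow>
      \<exists>r\<in>carrier R. \<exists>y\<in>carrier M. r \<odot>\<^bsub>M\<^esub> x = h y \<and> r \<odot>\<^bsub>M\<^esub> x \<noteq> \<zero>\<^bsub>M\<^esub>"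
  shows "h \<in> mod_aut R M"
proof -
  note H = mod_endD[OF h]
  obtain k where k: "k \<in> mod_end R M" and kG: "\<And>x y. (x, y) \<in> (\<lambda>x. (h x, x)) ` carrier M \<Longrightarrow> k x = y"
  proof (rule linear_relation_extends[of "(\<lambda>x. (h x, x)) ` carrier M"])
    show "(\<zero>\<^bsub>M\<^esub>, \<zero>\<^bsub>M\<^esub>) \<in> (\<lambda>x. (h x, x)) ` carrier M" using H(4) by force
  qed (use inj in \<open>auto simp: H image_iff\<close>)
  note k' = mod_endD[OF k]
  have kh: "k (h x) = x" if "x \<in> carrier M" for x using kG that by blast
  have kinj: "x = \<zero>\<^bsub>M\<^esub>" if x: "x \<in> carrier M" and "k x = \<zero>\<^bsub>M\<^esub>" for x
  proof (rule ccontr)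
    assume "x \<noteq> \<zero>\<^bsub>M\<^esub>"
    then obtain r y where r: "r \<in> carrier R" "y \<in> carrier M" "r \<odot>\<^bsub>M\<^esub> x = h y" "r \<odot>\<^bsub>M\<^esub> x \<noteq> \<zero>\<^bsub>M\<^esub>"
      using ess x by blast
    hence "y = k (r \<odot>\<^bsub>M\<^esub> x)" using kh by simp
    also have "\<dots> = \<zero>\<^bsub>M\<^esub>" by (simp only: k'(3)[OF r(1) x] that(2) smult_r_null[OF r(1)])
    finally show False using r H(4) by simp
  qed
  have hk: "h (k x) = x" if x: "x \<in> carrier M" for x
  proof -
    have "k (h (k x) \<ominus>\<^bsub>M\<^esub> x) = \<zero>\<^bsub>M\<^esub>" using x by (simp add: k' H kh diff_eq_zero_iff)
    thus ?thesis using kinj[of "h (k x) \<ominus>\<^bsub>M\<^esub> x"] x by (simp add: k' H diff_eq_zero_iff)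
  qed
  have "bij_betw h (carrier M) (carrier M)"
    by (rule bij_betw_byWitness[of _ k]) (auto simp: kh hk H k')
  thus ?thesis using h by (simp add: mod_aut_def)
qed

text \<open>The map is \<open>g\<close> on the image of \<open>\<pi>\<close> and the identity on the
  kernel of \<open>\<pi>\<close>, so injectivity and essentiality of the image are inherited from
  \<open>g\<close>. It turns automorphisms of a summand into automorphisms of
  \<open>M\<close>.\<close>

lemma summand_mono_aut:
  assumes \<pi>: "\<pi> \<in> mod_end R M" and idem: "\<And>x. x \<in> carrier M \<Longrightarrow> \<pi> (\<pi> x) = \<pi> x"
    and g: "g \<in> mod_end R M" and \<pi>g: "\<And>x. x \<in> carrier M \<Longrightarrow> \<pi> (g (\<pi> x)) = g (\<pi> x)"
    and inj: "\<And>x. x \<in> carrier M \<Longrightarrow> g (\<pi> x) = \<zero>\<^bsub>M\<^esub> \<Longrightarrow> \<pi> x = \<zero>\<^bsub>M\<^esub>"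
    and ess: "\<And>x. x \<in> carrier M \<Longrightarrow> \<pi> x \<noteq> \<zero>\<^bsub>M\<^esub> \<Longrightarrow>
      \<exists>r\<in>carrier R. \<exists>y\<in>carrier M. r \<odot>\<^bsub>M\<^esub> \<pi> x = g (\<pi> y) \<and> r \<odot>\<^bsub>M\<^esub> \<pi> x \<noteq> \<zero>\<^bsub>M\<^esub>"
  shows "(\<lambda>x. g (\<pi> x) \<oplus>\<^bsub>M\<^esub> (x \<ominus>\<^bsub>M\<^esub> \<pi> x)) \<in> mod_aut R M" (is "?h \<in> _")
proof (rule essential_mono_aut)
  note p = mod_endD[OF \<pi>] and G = mod_endD[OF g]
  show "?h \<in> mod_end R M"
    by (intro mod_end_add mod_end_diff mod_end_id mod_end_compose[OF g \<pi>] \<pi>)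
  have \<pi>h: "\<pi> (?h x) = g (\<pi> x)" if "x \<in> carrier M" for x
    using that by (simp add: p G \<pi>g idem diff_self)
  show "x = \<zero>\<^bsub>M\<^esub>" if x: "x \<in> carrier M" and "?h x = \<zero>\<^bsub>M\<^esub>" for x
  proof -
    have "g (\<pi> x) = \<zero>\<^bsub>M\<^esub>" using \<pi>h[OF x] that p(4) by simp
    moreover from this have "\<pi> x = \<zero>\<^bsub>M\<^esub>" using inj x by simp
    ultimately show ?thesis using that by (simp add: diff_zero)
  qed
  show "\<exists>r\<in>carrier R. \<exists>y\<in>carrier M. r \<odot>\<^bsub>M\<^esub> x = ?h y \<and> r \<odot>\<^bsub>M\<^esub> x \<noteq> \<zero>\<^bsub>M\<^esub>"
    if x: "x \<in> carrier M" "x \<noteq> \<zero>\<^bsub>M\<^esub>" for x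
  proof (cases "\<pi> x = \<zero>\<^bsub>M\<^esub>")
    case True
    hence "\<one>\<^bsub>R\<^esub> \<odot>\<^bsub>M\<^esub> x = ?h x \<and> \<one>\<^bsub>R\<^esub> \<odot>\<^bsub>M\<^esub> x \<noteq> \<zero>\<^bsub>M\<^esub>" using x by (simp add: G diff_zero)
    thus ?thesis using x by blast
  next
    case False
    then obtain r y where r: "r \<in> carrier R" "y \<in> carrier M" "r \<odot>\<^bsub>M\<^esub> \<pi> x = g (\<pi> y)" "r \<odot>\<^bsub>M\<^esub> \<pi> x \<noteq> \<zero>\<^bsub>M\<^esub>"
      using ess x by blast
    \<comment> \<open>The component in the image of \<open>\<pi>\<close> comes from
      \<open>y\<close>; the complementary one is that of \<open>r x\<close>, on which
      \<open>?h\<close> is the identity.\<close>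
    let ?y = "\<pi> y \<oplus>\<^bsub>M\<^esub> r \<odot>\<^bsub>M\<^esub> (x \<ominus>\<^bsub>M\<^esub> \<pi> x)"
    have y: "?y \<in> carrier M" using r x by (simp add: p)
    have "\<pi> (r \<odot>\<^bsub>M\<^esub> (x \<ominus>\<^bsub>M\<^esub> \<pi> x)) = \<zero>\<^bsub>M\<^esub>"
      using r x by (simp add: p idem diff_self)
    hence \<pi>y: "\<pi> ?y = \<pi> y" using r x by (simp add: p idem)
    have "?h ?y = r \<odot>\<^bsub>M\<^esub> \<pi> x \<oplus>\<^bsub>M\<^esub> r \<odot>\<^bsub>M\<^esub> (x \<ominus>\<^bsub>M\<^esub> \<pi> x)"
      unfolding \<pi>y r(3) using r(1,2) x by (simp only: add_diff_cancel p M.minus_closed smult_closed)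
    also have "\<dots> = r \<odot>\<^bsub>M\<^esub> (\<pi> x \<oplus>\<^bsub>M\<^esub> (x \<ominus>\<^bsub>M\<^esub> \<pi> x))"
      using r(1) x by (simp only: smult_r_distr p M.minus_closed)
    also have "\<dots> = r \<odot>\<^bsub>M\<^esub> x"
      using x by (simp only: add_diff_cancel p)
    finally have "r \<odot>\<^bsub>M\<^esub> x = ?h ?y" ..
    moreover have "r \<odot>\<^bsub>M\<^esub> x \<noteq> \<zero>\<^bsub>M\<^esub>" using r(4) p(3)[OF r(1) x(1)] p(4) by auto
    ultimately show ?thesis using y r(1) by blast
  qed
qed

end

section \<open>Submodules stable under automorphisms\<close>

locale aut_stable_submodule = injective_mod +
  fixes H
  assumes sub: "submodule H R M"
    and aut_stable: "\<And>f x. f \<in> mod_aut R M \<Longrightarrow> x \<in> H \<Longrightarrow> f x \<in> H"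
begin

lemmas H = submoduleD[OF sub]

section \<open>Maps under which \<open>H\<close> is stable: inverses, square-zero endomorphisms,
  projections\<close>

lemma aut_reflects:
  assumes f: "f \<in> mod_aut R M" and x: "x \<in> carrier M" "f x \<in> H"
  shows "x \<in> H"
proof -
  have "bij_betw f (carrier M) (carrier M)" using f by (simp add: mod_aut_def)
  from bij_betw_inv_into_left[OF this x(1)] aut_stable[OF mod_aut_inv[OF f] x(2)]
  show ?thesis by simp
qed

text \<open>Because \<open>g\<close> has square zero, \<open>1 - g\<close> is inverse to
  \<open>1 + g\<close>. Subtracting \<open>x\<close> from its image under \<open>1 + g\<close>
  leaves \<open>g x\<close>.\<close>

lemma square_zero_stable:
  assumes g: "g \<in> mod_end R M" and sq: "\<And>x. x \<in> carrier M \<Longrightarrow> g (g x) = \<zero>\<^bsub>M\<^esub>" and x: "x \<in> H"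
  shows "g x \<in> H"
proof -
  note G = mod_endD[OF g]
  have "(\<lambda>x. x \<oplus>\<^bsub>M\<^esub> g x) \<in> mod_aut R M"
    unfolding mod_aut_def
  proof (intro CollectI conjI)
    show "(\<lambda>x. x \<oplus>\<^bsub>M\<^esub> g x) \<in> mod_end R M" by (intro mod_end_add mod_end_id g)
    show "bij_betw (\<lambda>x. x \<oplus>\<^bsub>M\<^esub> g x) (carrier M) (carrier M)"
    proof (rule bij_betw_byWitness[of _ "\<lambda>x. x \<ominus>\<^bsub>M\<^esub> g x"])
      show "\<forall>x\<in>carrier M. (x \<oplus>\<^bsub>M\<^esub> g x) \<ominus>\<^bsub>M\<^esub> g (x \<oplus>\<^bsub>M\<^esub> g x) = x"
        by (simp add: G sq) (simp add: a_minus_def G M.a_assoc M.r_neg)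
      show "\<forall>x\<in>carrier M. (x \<ominus>\<^bsub>M\<^esub> g x) \<oplus>\<^bsub>M\<^esub> g (x \<ominus>\<^bsub>M\<^esub> g x) = x"
        by (simp add: G sq diff_zero add_diff_cancel)
    qed (auto simp: G)
  qed
  from aut_stable[OF this x] have "(x \<oplus>\<^bsub>M\<^esub> g x) \<ominus>\<^bsub>M\<^esub> x \<in> H" using H(4) x by blast
  thus ?thesis using add_diff_cancel(2)[of x "g x"] G(1) H(1) x by simp
qed

text \<open>
  The projection is the product of two square-zero endomorphisms: \<open>(1 - \<pi>) h \<pi>\<close> embeds the image
  of \<open>\<pi>\<close> into the kernel of \<open>\<pi>\<close>, and an extension of the inverse of this embedding leads back.
\<close>

lemma projection_stable:
  assumes \<pi>: "\<pi> \<in> mod_end R M" and idem: "\<And>x. x \<in> carrier M \<Longrightarrow> \<pi> (\<pi> x) = \<pi> x"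
    and h: "h \<in> mod_end R M"
    and inj: "\<And>x. x \<in> carrier M \<Longrightarrow> h (\<pi> x) \<ominus>\<^bsub>M\<^esub> \<pi> (h (\<pi> x)) = \<zero>\<^bsub>M\<^esub> \<Longrightarrow> \<pi> x = \<zero>\<^bsub>M\<^esub>"
    and x: "x \<in> H"
  shows "\<pi> x \<in> H"
proof -
  note p = mod_endD[OF \<pi>]
  define u where "u y = h (\<pi> y) \<ominus>\<^bsub>M\<^esub> \<pi> (h (\<pi> y))" for y
  have u: "u \<in> mod_end R M"
    unfolding u_def by (intro mod_end_diff mod_end_compose[OF \<pi>] mod_end_compose[OF h \<pi>])
  note U = mod_endD[OF u]
  have \<pi>u: "\<pi> (u y) = \<zero>\<^bsub>M\<^esub>" if "y \<in> carrier M" for y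
    using that by (simp add: u_def p mod_endD[OF h] idem diff_self)
  have uz: "u y = \<zero>\<^bsub>M\<^esub>" if "y \<in> carrier M" "\<pi> y = \<zero>\<^bsub>M\<^esub>" for y
    using that by (simp add: u_def p mod_endD(4)[OF h] diff_self)
  \<comment> \<open>The graph of the inverse of the embedding, sending \<open>u y\<close> back to
    \<open>\<pi> y\<close>; by the hypothesis \<open>inj\<close>, \<open>u y = 0\<close> forces
    \<open>\<pi> y = 0\<close>.\<close>
  let ?G = "(\<lambda>y. (u y, \<pi> y)) ` carrier M"
  obtain k where k: "k \<in> mod_end R M" and kG: "\<And>a b. (a, b) \<in> ?G \<Longrightarrow> k a = b"
  proof (rule linear_relation_extends[of ?G])
    show "(\<zero>\<^bsub>M\<^esub>, \<zero>\<^bsub>M\<^esub>) \<in> ?G" using U(4) p(4) by force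
    show "y = \<zero>\<^bsub>M\<^esub>" if "(\<zero>\<^bsub>M\<^esub>, y) \<in> ?G" for y using that inj unfolding u_def by force
    show "(a \<oplus>\<^bsub>M\<^esub> a', b \<oplus>\<^bsub>M\<^esub> b') \<in> ?G" if "(a, b) \<in> ?G" "(a', b') \<in> ?G" for a b a' b'
      using that by (auto simp: image_iff simp flip: U(2) p(2))
    show "(r \<odot>\<^bsub>M\<^esub> a, r \<odot>\<^bsub>M\<^esub> b) \<in> ?G" if "r \<in> carrier R" "(a, b) \<in> ?G" for r a b
      using that by (auto simp: image_iff simp flip: U(3) p(3))
  qed (use U(1) p(1) in auto)
  have ku: "k (u y) = \<pi> y" if "y \<in> carrier M" for y using kG that by blast
  note K = mod_endD[OF k]
  \<comment> \<open>The factors \<open>1 - \<pi>\<close> before and \<open>\<pi>\<close> after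
    \<open>k\<close> force square zero. Since \<open>\<pi>\<close> kills \<open>u x\<close>, they do
    not disturb the value \<open>v (u x) = \<pi> x\<close>.\<close>
  define v where "v y = \<pi> (k (y \<ominus>\<^bsub>M\<^esub> \<pi> y))" for y
  have v: "v \<in> mod_end R M"
    unfolding v_def
    by (rule mod_end_compose[OF \<pi> mod_end_compose[OF k mod_end_diff[OF mod_end_id \<pi>]]])
  have xc: "x \<in> carrier M" using x H(1) by simp
  have "u x \<in> H" using u _ x
    by (rule square_zero_stable) (simp add: uz \<pi>u U)
  hence "v (u x) \<in> H"
    using v
  proof (rule square_zero_stable[rotated 2])
    show "v (v y) = \<zero>\<^bsub>M\<^esub>" if "y \<in> carrier M" for y
      using that by (simp add: v_def K p idem diff_self)
  qed
  also have "v (u x) = \<pi> x" using xc by (simp add: v_def \<pi>u ku U diff_zero idem)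
  finally show ?thesis .
qed

text \<open>
  Here \<open>x - y\<close> is killed by a power of \<open>s\<close>. The element \<open>y\<close> is obtained from \<open>s\<^sup>n x \<in> H\<close>, for \<open>n\<close> so
  large that \<open>s\<close> is injective on \<open>R s\<^sup>n x\<close>, by the inverse of the automorphism that acts as \<open>s\<^sup>n\<close>
  on a hull of \<open>R s\<^sup>n x\<close> and as the identity on a complement.
\<close>

lemma split_along_scalar:
  assumes noeth: "noetherian_ring R"
    and x: "x \<in> H" and s: "s \<in> carrier R"
    and a: "a \<in> carrier R" and sa: "s \<odot>\<^bsub>M\<^esub> (a \<odot>\<^bsub>M\<^esub> x) = \<zero>\<^bsub>M\<^esub>" and ax: "a \<odot>\<^bsub>M\<^esub> x \<noteq> \<zero>\<^bsub>M\<^esub>"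
    and bx: "\<And>n. (s [^]\<^bsub>R\<^esub> (n::nat)) \<odot>\<^bsub>M\<^esub> x \<noteq> \<zero>\<^bsub>M\<^esub>"
  obtains y where "y \<in> H" "ann x \<subset> ann y" "ann x \<subset> ann (x \<ominus>\<^bsub>M\<^esub> y)"
proof -
  interpret noetherian_ring R by fact
  have xc: "x \<in> carrier M" using x H(1) by simp
  define z where "z n = (s [^]\<^bsub>R\<^esub> (n::nat)) \<odot>\<^bsub>M\<^esub> x" for n
  have sn: "s [^]\<^bsub>R\<^esub> (n::nat) \<in> carrier R" for n using s by simp
  have zc: "z n \<in> carrier M" for n using sn xc by (simp add: z_def)
  have zSuc: "z (Suc n) = s \<odot>\<^bsub>M\<^esub> z n" for n
    using s sn xc by (simp add: z_def smult_assoc1 smult_comm[of s])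
  \<comment> \<open>The annihilators of \<open>s^m x\<close> with \<open>m > 0\<close> ascend, and
    one of them is maximal. The positive exponent matters at the end: since
    \<open>s a x = 0\<close>, it puts \<open>a\<close> into the chosen annihilator.\<close>
  have "range (\<lambda>n. ann (z (Suc n))) \<noteq> {}" by blast
  moreover have "ideal J R" if "J \<in> range (\<lambda>n. ann (z (Suc n)))" for J
    using that ann_ideal[OF zc] by blast
  ultimately have "\<exists>I\<in>range (\<lambda>n. ann (z (Suc n))). \<forall>J\<in>range (\<lambda>n. ann (z (Suc n))). I \<subseteq> J \<longrightarrow> J = I"
    by (rule ideal_family_maximal)
  then obtain I where "I \<in> range (\<lambda>n. ann (z (Suc n)))"
    and I: "\<forall>J\<in>range (\<lambda>n. ann (z (Suc n))). I \<subseteq> J \<longrightarrow> J = I" by (rule bexE)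
  then obtain n where "I = ann (z (Suc n))" by (elim rangeE)
  with I have n: "ann (z (Suc m)) = ann (z (Suc n))" if "ann (z (Suc n)) \<subseteq> ann (z (Suc m))" for m
    using that by simp
  define t where "t = s [^]\<^bsub>R\<^esub> Suc n"
  have t: "t \<in> carrier R" unfolding t_def by (rule sn)
  have tx: "t \<odot>\<^bsub>M\<^esub> x = z (Suc n)" by (simp add: t_def z_def)
  have mono: "ann (z m) \<subseteq> ann (z (m + k))" for m k
  proof (induction k)
    case (Suc k)
    thus ?case using ann_smult_mono[OF zc s, of "m + k"] by (simp add: zSuc)
  qed simp
  have stable: "ann (z (Suc n + k)) = ann (z (Suc n))" for k
    using n[of "n + k"] mono[of "Suc n" k] by simp
  have z_add: "z (m + k) = (s [^]\<^bsub>R\<^esub> m) \<odot>\<^bsub>M\<^esub> z k" for m k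
    using s sn xc by (simp add: z_def smult_assoc1 flip: R.nat_pow_mult)
  \<comment> \<open>A further factor \<open>t\<close> leads from exponent \<open>Suc n\<close> to
    twice that exponent, where the annihilator is still the same; so \<open>t\<close> is injective
    on the cyclic submodule generated by \<open>z (Suc n)\<close>.\<close>
  have t_inj_z: "r \<odot>\<^bsub>M\<^esub> z (Suc n) = \<zero>\<^bsub>M\<^esub>"
    if r: "r \<in> carrier R" "t \<odot>\<^bsub>M\<^esub> (r \<odot>\<^bsub>M\<^esub> z (Suc n)) = \<zero>\<^bsub>M\<^esub>" for r
  proof -
    have "r \<odot>\<^bsub>M\<^esub> z (Suc n + Suc n) = \<zero>\<^bsub>M\<^esub>"
      using r zc t by (simp only: z_add[of "Suc n" "Suc n"] flip: t_def) (simp add: smult_comm)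
    hence "r \<in> ann (z (Suc n + Suc n))" using r by (simp add: ann_def)
    thus ?thesis unfolding stable by (simp add: ann_def)
  qed
  have zero_sub: "submodule {\<zero>\<^bsub>M\<^esub>} R M" by (rule submodule_introI) auto
  obtain \<pi> where \<pi>: "\<pi> \<in> mod_end R M" and idem: "\<And>x. x \<in> carrier M \<Longrightarrow> \<pi> (\<pi> x) = \<pi> x"
    and \<pi>z: "\<And>x. x \<in> {r \<odot>\<^bsub>M\<^esub> z (Suc n) |r. r \<in> carrier R} \<Longrightarrow> \<pi> x = x"
    and ess: "\<And>x. x \<in> carrier M \<Longrightarrow> \<pi> x \<noteq> \<zero>\<^bsub>M\<^esub> \<Longrightarrow>
      \<exists>r\<in>carrier R. r \<odot>\<^bsub>M\<^esub> \<pi> x \<in> {r \<odot>\<^bsub>M\<^esub> z (Suc n) |r. r \<in> carrier R} \<and> r \<odot>\<^bsub>M\<^esub> \<pi> x \<noteq> \<zero>\<^bsub>M\<^esub>"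
    by (rule submodule_projection[OF cyclic_submodule[OF zc[of "Suc n"]] zero_sub inf_le2]) blast
  note p = mod_endD[OF \<pi>]
  \<comment> \<open>Injectivity of \<open>t\<close> spreads to an essential extension: a nonzero
    element killed by \<open>t\<close> would have a nonzero multiple in the cyclic submodule, also
    killed by \<open>t\<close>.\<close>
  have t_inj: "\<pi> u = \<zero>\<^bsub>M\<^esub>" if u: "u \<in> carrier M" "t \<odot>\<^bsub>M\<^esub> \<pi> u = \<zero>\<^bsub>M\<^esub>" for u
  proof (rule ccontr)
    assume "\<pi> u \<noteq> \<zero>\<^bsub>M\<^esub>"
    then obtain r q where r: "r \<in> carrier R" "q \<in> carrier R" "r \<odot>\<^bsub>M\<^esub> \<pi> u = q \<odot>\<^bsub>M\<^esub> z (Suc n)"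
      "r \<odot>\<^bsub>M\<^esub> \<pi> u \<noteq> \<zero>\<^bsub>M\<^esub>" using ess u(1) by blast
    have "t \<odot>\<^bsub>M\<^esub> (q \<odot>\<^bsub>M\<^esub> z (Suc n)) = r \<odot>\<^bsub>M\<^esub> (t \<odot>\<^bsub>M\<^esub> \<pi> u)"
      using r(1) t u(1) p(1) by (simp add: smult_comm[of t r] flip: r(3))
    hence "t \<odot>\<^bsub>M\<^esub> (q \<odot>\<^bsub>M\<^esub> z (Suc n)) = \<zero>\<^bsub>M\<^esub>" using u r by simp
    thus False using t_inj_z r by simp
  qed
  let ?h = "\<lambda>u. t \<odot>\<^bsub>M\<^esub> \<pi> u \<oplus>\<^bsub>M\<^esub> (u \<ominus>\<^bsub>M\<^esub> \<pi> u)"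
  have haut: "?h \<in> mod_aut R M"
  proof (rule summand_mono_aut[OF \<pi> idem mod_end_smult[OF t]])
    \<comment> \<open>The multiplier is \<open>t\<close> itself: \<open>t \<pi> u\<close> is visibly
      in the image, and it is nonzero by \<open>t_inj\<close>.\<close>
    show "\<exists>r\<in>carrier R. \<exists>y\<in>carrier M. r \<odot>\<^bsub>M\<^esub> \<pi> u = t \<odot>\<^bsub>M\<^esub> \<pi> y \<and> r \<odot>\<^bsub>M\<^esub> \<pi> u \<noteq> \<zero>\<^bsub>M\<^esub>"
      if "u \<in> carrier M" "\<pi> u \<noteq> \<zero>\<^bsub>M\<^esub>" for u
      using that t t_inj by blast
  qed (use t t_inj in \<open>auto simp: p idem\<close>)
  have "?h ` carrier M = carrier M" using haut by (simp add: mod_aut_def bij_betw_def)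
  hence "z (Suc n) \<in> ?h ` carrier M" using zc by (simp only:)
  \<comment> \<open>\<open>y\<close> is \<open>t x\<close> divided by \<open>t\<close> within the
    hull: the next steps show that it has no component outside the hull and that
    \<open>t y = t x\<close>.\<close>
  then obtain y where hy: "z (Suc n) = ?h y" and yc: "y \<in> carrier M" by (rule imageE)
  note y = yc hy[symmetric]
  have "z (Suc n) \<in> H" using H(5)[OF t x] tx by simp
  hence yH: "y \<in> H" using aut_reflects[OF haut y(1)] y(2) by simp
  have "t \<odot>\<^bsub>M\<^esub> \<pi> y = \<pi> (?h y)" using y(1) t by (simp add: p idem diff_self)
  also have "\<dots> = z (Suc n)" using y(2) \<pi>z[OF mem_cyclic[OF zc]] by simp
  finally have ty: "t \<odot>\<^bsub>M\<^esub> \<pi> y = z (Suc n)" .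
  have "y \<ominus>\<^bsub>M\<^esub> \<pi> y = \<zero>\<^bsub>M\<^esub>"
    using y(2) ty y(1) zc add_diff_cancel(2)[of "z (Suc n)" "y \<ominus>\<^bsub>M\<^esub> \<pi> y"] p(1) diff_self by simp
  hence \<pi>y: "\<pi> y = y" using diff_eq_zero_iff p(1) y(1) by metis
  have ann_y: "ann y = ann (z (Suc n))"
  proof
    show "ann y \<subseteq> ann (z (Suc n))" using ann_smult_mono[OF y(1) t] ty \<pi>y by simp
    show "ann (z (Suc n)) \<subseteq> ann y"
    proof
      fix r assume "r \<in> ann (z (Suc n))"
      hence r: "r \<in> carrier R" "r \<odot>\<^bsub>M\<^esub> z (Suc n) = \<zero>\<^bsub>M\<^esub>" by (auto simp: ann_def)
      have "t \<odot>\<^bsub>M\<^esub> (r \<odot>\<^bsub>M\<^esub> y) = r \<odot>\<^bsub>M\<^esub> z (Suc n)" using ty \<pi>y r(1) t y(1) smult_comm by metis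
      hence "t \<odot>\<^bsub>M\<^esub> \<pi> (r \<odot>\<^bsub>M\<^esub> y) = \<zero>\<^bsub>M\<^esub>" using r \<pi>y p(3) y(1) by simp
      hence "\<pi> (r \<odot>\<^bsub>M\<^esub> y) = \<zero>\<^bsub>M\<^esub>" using t_inj r(1) y(1) by simp
      thus "r \<in> ann y" using p(3) r(1) y(1) \<pi>y by (simp add: ann_def)
    qed
  qed
  have le: "ann x \<subseteq> ann y" using ann_smult_mono[OF xc t] tx ann_y by simp
  have "s \<odot>\<^bsub>M\<^esub> (a \<odot>\<^bsub>M\<^esub> z n) = \<zero>\<^bsub>M\<^esub>"
  proof -
    have "s \<odot>\<^bsub>M\<^esub> (a \<odot>\<^bsub>M\<^esub> z n) = (s [^]\<^bsub>R\<^esub> n) \<odot>\<^bsub>M\<^esub> (s \<odot>\<^bsub>M\<^esub> (a \<odot>\<^bsub>M\<^esub> x))"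
      unfolding z_def using s a sn xc smult_comm by (metis smult_closed)
    thus ?thesis using sa sn by simp
  qed
  hence "a \<in> ann (z (Suc n))" using a s zc by (simp add: ann_def zSuc smult_comm[of a s])
  \<comment> \<open>Strictness has two witnesses: \<open>a\<close> kills \<open>y\<close> but not
    \<open>x\<close>, and \<open>t\<close> kills \<open>x - y\<close> but, by \<open>bx\<close>, not
    \<open>x\<close>.\<close>
  hence "a \<in> ann y" "a \<notin> ann x" using ann_y ax by (auto simp: ann_def)
  with le have lt1: "ann x \<subset> ann y" by blast
  have "ann x \<subseteq> ann (x \<ominus>\<^bsub>M\<^esub> y)"
    using le xc y(1) by (auto simp: ann_def smult_r_diff diff_self)
  moreover have "t \<in> ann (x \<ominus>\<^bsub>M\<^esub> y)"
    using t xc y(1) ty \<pi>y zc by (simp add: ann_def smult_r_diff tx diff_self)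
  moreover have "t \<notin> ann x" using bx[of "Suc n"] by (simp add: ann_def t_def)
  ultimately have lt2: "ann x \<subset> ann (x \<ominus>\<^bsub>M\<^esub> y)" by blast
  show thesis by (rule that[OF yH lt1 lt2])
qed

text \<open>On the hull of \<open>R x\<close> the kernels of \<open>\<pi> f\<close> and
  \<open>1 - \<pi> f\<close> meet only in zero, so uniformity forces one of them to vanish. That is
  why one of the two maps is injective there, hence invertible.\<close>

lemma uniform_stable:
  assumes x: "x \<in> H" and f: "f \<in> mod_end R M"
    and uniform: "\<And>a b. a \<in> carrier R \<Longrightarrow> b \<in> carrier R \<Longrightarrow> a \<odot>\<^bsub>M\<^esub> x \<noteq> \<zero>\<^bsub>M\<^esub> \<Longrightarrow> b \<odot>\<^bsub>M\<^esub> x \<noteq> \<zero>\<^bsub>M\<^esub> \<Longrightarrow>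
      \<exists>r\<in>carrier R. \<exists>t\<in>carrier R. r \<odot>\<^bsub>M\<^esub> (a \<odot>\<^bsub>M\<^esub> x) = t \<odot>\<^bsub>M\<^esub> (b \<odot>\<^bsub>M\<^esub> x) \<and> r \<odot>\<^bsub>M\<^esub> (a \<odot>\<^bsub>M\<^esub> x) \<noteq> \<zero>\<^bsub>M\<^esub>"
  shows "f x \<in> H"
proof -
  have xc: "x \<in> carrier M" using x H(1) by simp
  have zero_sub: "submodule {\<zero>\<^bsub>M\<^esub>} R M" by (rule submodule_introI) auto
  obtain \<pi> where \<pi>: "\<pi> \<in> mod_end R M" and idem: "\<And>x. x \<in> carrier M \<Longrightarrow> \<pi> (\<pi> x) = \<pi> x"
    and \<pi>N: "\<And>y. y \<in> {r \<odot>\<^bsub>M\<^esub> x |r. r \<in> carrier R} \<Longrightarrow> \<pi> y = y"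
    and ess: "\<And>y. y \<in> carrier M \<Longrightarrow> \<pi> y \<noteq> \<zero>\<^bsub>M\<^esub> \<Longrightarrow>
      \<exists>r\<in>carrier R. r \<odot>\<^bsub>M\<^esub> \<pi> y \<in> {r \<odot>\<^bsub>M\<^esub> x |r. r \<in> carrier R} \<and> r \<odot>\<^bsub>M\<^esub> \<pi> y \<noteq> \<zero>\<^bsub>M\<^esub>"
    by (rule submodule_projection[OF cyclic_submodule[OF xc] zero_sub inf_le2]) blast
  note p = mod_endD[OF \<pi>] and F = mod_endD[OF f]
  have \<pi>x: "\<pi> x = x" using \<pi>N mem_cyclic[OF xc] by blast
  \<comment> \<open>Uniformity passes to the hull: essentiality moves both elements to nonzero
    elements of \<open>R x\<close>, where the hypothesis provides a common nonzero multiple.\<close>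
  have unif: "\<exists>r\<in>carrier R. \<exists>t\<in>carrier R. r \<odot>\<^bsub>M\<^esub> \<pi> y = t \<odot>\<^bsub>M\<^esub> \<pi> z \<and> r \<odot>\<^bsub>M\<^esub> \<pi> y \<noteq> \<zero>\<^bsub>M\<^esub>"
    if y: "y \<in> carrier M" "\<pi> y \<noteq> \<zero>\<^bsub>M\<^esub>" and z: "z \<in> carrier M" "\<pi> z \<noteq> \<zero>\<^bsub>M\<^esub>" for y z
  proof -
    from ess[OF y] obtain r a where r: "r \<in> carrier R" "a \<in> carrier R"
      "r \<odot>\<^bsub>M\<^esub> \<pi> y = a \<odot>\<^bsub>M\<^esub> x" "a \<odot>\<^bsub>M\<^esub> x \<noteq> \<zero>\<^bsub>M\<^esub>" by force
    from ess[OF z] obtain t b where t: "t \<in> carrier R" "b \<in> carrier R"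
      "t \<odot>\<^bsub>M\<^esub> \<pi> z = b \<odot>\<^bsub>M\<^esub> x" "b \<odot>\<^bsub>M\<^esub> x \<noteq> \<zero>\<^bsub>M\<^esub>" by force
    obtain u v where uv: "u \<in> carrier R" "v \<in> carrier R"
      "u \<odot>\<^bsub>M\<^esub> (a \<odot>\<^bsub>M\<^esub> x) = v \<odot>\<^bsub>M\<^esub> (b \<odot>\<^bsub>M\<^esub> x)" "u \<odot>\<^bsub>M\<^esub> (a \<odot>\<^bsub>M\<^esub> x) \<noteq> \<zero>\<^bsub>M\<^esub>"
      using uniform r(2,4) t(2,4) by blast
    have "(u \<otimes>\<^bsub>R\<^esub> r) \<odot>\<^bsub>M\<^esub> \<pi> y = u \<odot>\<^bsub>M\<^esub> (a \<odot>\<^bsub>M\<^esub> x)"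
      using uv(1) r(1,3) y(1) p(1) by (simp add: smult_assoc1)
    moreover have "(v \<otimes>\<^bsub>R\<^esub> t) \<odot>\<^bsub>M\<^esub> \<pi> z = v \<odot>\<^bsub>M\<^esub> (b \<odot>\<^bsub>M\<^esub> x)"
      using uv(2) t(1,3) z(1) p(1) by (simp add: smult_assoc1)
    ultimately show ?thesis using uv r(1) t(1) by (metis R.m_closed)
  qed
  \<comment> \<open>By \<open>unif\<close>, a nonzero element of the hull and its image under an
    injective \<open>g\<close> share a nonzero multiple, so the image is essential and
    \<open>summand_mono_aut\<close> applies. The resulting automorphism acts on \<open>x\<close> as
    \<open>g\<close> because \<open>\<pi> x = x\<close>.\<close>
  have mono_stable: "g x \<in> H"
    if g: "g \<in> mod_end R M" and \<pi>g: "\<And>x. x \<in> carrier M \<Longrightarrow> \<pi> (g (\<pi> x)) = g (\<pi> x)"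
      and inj: "\<And>x. x \<in> carrier M \<Longrightarrow> g (\<pi> x) = \<zero>\<^bsub>M\<^esub> \<Longrightarrow> \<pi> x = \<zero>\<^bsub>M\<^esub>" for g
  proof -
    note G = mod_endD[OF g]
    have "(\<lambda>x. g (\<pi> x) \<oplus>\<^bsub>M\<^esub> (x \<ominus>\<^bsub>M\<^esub> \<pi> x)) \<in> mod_aut R M"
    proof (rule summand_mono_aut[OF \<pi> idem g \<pi>g inj])
      fix y assume y: "y \<in> carrier M" "\<pi> y \<noteq> \<zero>\<^bsub>M\<^esub>"
      hence "\<pi> (g (\<pi> y)) \<noteq> \<zero>\<^bsub>M\<^esub>" using \<pi>g inj by metis
      then obtain r t where r: "r \<in> carrier R" "t \<in> carrier R"
        "r \<odot>\<^bsub>M\<^esub> \<pi> y = t \<odot>\<^bsub>M\<^esub> \<pi> (g (\<pi> y))" "r \<odot>\<^bsub>M\<^esub> \<pi> y \<noteq> \<zero>\<^bsub>M\<^esub>"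
        using unif[of y "g (\<pi> y)"] y G(1) p(1) by blast
      have "r \<odot>\<^bsub>M\<^esub> \<pi> y = g (\<pi> (t \<odot>\<^bsub>M\<^esub> y))" using r y by (simp add: \<pi>g p G)
      thus "\<exists>r\<in>carrier R. \<exists>z\<in>carrier M. r \<odot>\<^bsub>M\<^esub> \<pi> y = g (\<pi> z) \<and> r \<odot>\<^bsub>M\<^esub> \<pi> y \<noteq> \<zero>\<^bsub>M\<^esub>"
        using r y(1) by blast
    qed
    from aut_stable[OF this x] show ?thesis using xc G(1) by (simp add: \<pi>x diff_self)
  qed
  have pf: "(\<lambda>y. \<pi> (f y)) \<in> mod_end R M" by (rule mod_end_compose[OF \<pi> f])
  have "\<pi> (f x) \<in> H"
  proof (cases "\<forall>y\<in>carrier M. \<pi> (f (\<pi> y)) = \<zero>\<^bsub>M\<^esub> \<longrightarrow> \<pi> y = \<zero>\<^bsub>M\<^esub>")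
    case True
    show ?thesis by (rule mono_stable[OF pf]) (use True in \<open>auto simp: p F idem\<close>)
  next
    case False
    then obtain w where w: "w \<in> carrier M" "\<pi> (f (\<pi> w)) = \<zero>\<^bsub>M\<^esub>" "\<pi> w \<noteq> \<zero>\<^bsub>M\<^esub>" by blast
    let ?g = "\<lambda>y. y \<ominus>\<^bsub>M\<^esub> \<pi> (f y)"
    have "?g x \<in> H"
    proof (rule mono_stable)
      show "?g \<in> mod_end R M" by (intro mod_end_diff mod_end_id pf)
      show "\<pi> (?g (\<pi> y)) = ?g (\<pi> y)" if "y \<in> carrier M" for y
        using that by (simp add: p F idem)
      show "\<pi> y = \<zero>\<^bsub>M\<^esub>" if y: "y \<in> carrier M" "?g (\<pi> y) = \<zero>\<^bsub>M\<^esub>" for y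
      proof (rule ccontr)
        assume "\<pi> y \<noteq> \<zero>\<^bsub>M\<^esub>"
        \<comment> \<open>A common nonzero multiple of \<open>\<pi> w\<close> and
          \<open>\<pi> y\<close> would be both killed and fixed by \<open>\<pi> f\<close>.\<close>
        then obtain r t where r: "r \<in> carrier R" "t \<in> carrier R" "r \<odot>\<^bsub>M\<^esub> \<pi> w = t \<odot>\<^bsub>M\<^esub> \<pi> y" "r \<odot>\<^bsub>M\<^esub> \<pi> w \<noteq> \<zero>\<^bsub>M\<^esub>"
          using unif[OF w(1,3) y(1)] by blast
        have "\<pi> y = \<pi> (f (\<pi> y))" using y diff_eq_zero_iff p F by simp
        hence "t \<odot>\<^bsub>M\<^esub> \<pi> y = \<pi> (f (t \<odot>\<^bsub>M\<^esub> \<pi> y))" using r(2) y(1) by (simp add: p F)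
        also have "\<dots> = r \<odot>\<^bsub>M\<^esub> \<pi> (f (\<pi> w))" using r(1) w(1) by (simp add: p F flip: r(3))
        finally show False using r w by simp
      qed
    qed
    hence "x \<ominus>\<^bsub>M\<^esub> ?g x \<in> H" using x H(4) by blast
    moreover have "x \<ominus>\<^bsub>M\<^esub> ?g x = \<pi> (f x)"
      using xc p(1) F(1) by (simp add: a_minus_def M.minus_add M.r_neg1 M.r_neg2)
    ultimately show ?thesis by simp
  qed
  moreover have "f x \<ominus>\<^bsub>M\<^esub> \<pi> (f x) \<in> H"
  proof -
    let ?g = "\<lambda>y. f (\<pi> y) \<ominus>\<^bsub>M\<^esub> \<pi> (f (\<pi> y))"
    have "?g x \<in> H"
    proof (rule square_zero_stable[OF _ _ x])
      show "?g \<in> mod_end R M" by (intro mod_end_diff mod_end_compose[OF f \<pi>] mod_end_compose[OF pf \<pi>])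
      show "?g (?g y) = \<zero>\<^bsub>M\<^esub>" if "y \<in> carrier M" for y
        using that by (simp add: p F idem diff_self)
    qed
    thus ?thesis by (simp add: \<pi>x)
  qed
  ultimately have "\<pi> (f x) \<oplus>\<^bsub>M\<^esub> (f x \<ominus>\<^bsub>M\<^esub> \<pi> (f x)) \<in> H" using H(3) by blast
  thus ?thesis using add_diff_cancel(1)[of "\<pi> (f x)" "f x"] xc p(1) F(1) by simp
qed

text \<open>Equal annihilators make \<open>r a x \<mapsto> r b x\<close> a well-defined isomorphism
  of cyclic submodules, and independence lets \<open>\<pi>\<close> be the identity on the first and
  zero on the second. An extension \<open>h\<close> of the isomorphism, followed by
  \<open>1 - \<pi>\<close>, embeds the hull into the complement, as \<open>projection_stable\<close>
  requires; the element sought is \<open>\<pi> x\<close>.\<close>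

lemma split_equal_annihilators:
  assumes x: "x \<in> H" and a: "a \<in> carrier R" and b: "b \<in> carrier R"
    and ax: "a \<odot>\<^bsub>M\<^esub> x \<noteq> \<zero>\<^bsub>M\<^esub>" and bx: "b \<odot>\<^bsub>M\<^esub> x \<noteq> \<zero>\<^bsub>M\<^esub>"
    and indep: "\<And>r t. r \<in> carrier R \<Longrightarrow> t \<in> carrier R \<Longrightarrow> r \<odot>\<^bsub>M\<^esub> (a \<odot>\<^bsub>M\<^esub> x) = t \<odot>\<^bsub>M\<^esub> (b \<odot>\<^bsub>M\<^esub> x) \<Longrightarrow>
      r \<odot>\<^bsub>M\<^esub> (a \<odot>\<^bsub>M\<^esub> x) = \<zero>\<^bsub>M\<^esub>"
    and ann_eq: "ann (a \<odot>\<^bsub>M\<^esub> x) = ann (b \<odot>\<^bsub>M\<^esub> x)"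
  obtains y where "y \<in> H" "ann x \<subset> ann y" "ann x \<subset> ann (x \<ominus>\<^bsub>M\<^esub> y)"
proof -
  have xc: "x \<in> carrier M" using x H(1) by simp
  define A where "A = {r \<odot>\<^bsub>M\<^esub> (a \<odot>\<^bsub>M\<^esub> x) |r. r \<in> carrier R}"
  define B where "B = {r \<odot>\<^bsub>M\<^esub> (b \<odot>\<^bsub>M\<^esub> x) |r. r \<in> carrier R}"
  have axc: "a \<odot>\<^bsub>M\<^esub> x \<in> carrier M" and bxc: "b \<odot>\<^bsub>M\<^esub> x \<in> carrier M" using a b xc by auto
  have A: "submodule A R M" "a \<odot>\<^bsub>M\<^esub> x \<in> A" and B: "submodule B R M" "b \<odot>\<^bsub>M\<^esub> x \<in> B"
    unfolding A_def B_def using cyclic_submodule mem_cyclic axc bxc by auto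
  have AB: "A \<inter> B \<subseteq> {\<zero>\<^bsub>M\<^esub>}" using indep by (auto simp: A_def B_def)
  obtain \<pi> where \<pi>: "\<pi> \<in> mod_end R M" and idem: "\<And>x. x \<in> carrier M \<Longrightarrow> \<pi> (\<pi> x) = \<pi> x"
    and \<pi>A: "\<And>x. x \<in> A \<Longrightarrow> \<pi> x = x" and \<pi>B: "\<And>x. x \<in> B \<Longrightarrow> \<pi> x = \<zero>\<^bsub>M\<^esub>"
    and ess: "\<And>y. y \<in> carrier M \<Longrightarrow> \<pi> y \<noteq> \<zero>\<^bsub>M\<^esub> \<Longrightarrow> \<exists>r\<in>carrier R. r \<odot>\<^bsub>M\<^esub> \<pi> y \<in> A \<and> r \<odot>\<^bsub>M\<^esub> \<pi> y \<noteq> \<zero>\<^bsub>M\<^esub>"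
    by (rule submodule_projection[OF A(1) B(1) AB]) blast
  note p = mod_endD[OF \<pi>]
  let ?G = "{(r \<odot>\<^bsub>M\<^esub> (a \<odot>\<^bsub>M\<^esub> x), r \<odot>\<^bsub>M\<^esub> (b \<odot>\<^bsub>M\<^esub> x)) |r. r \<in> carrier R}"
  have GI: "(r \<odot>\<^bsub>M\<^esub> (a \<odot>\<^bsub>M\<^esub> x), r \<odot>\<^bsub>M\<^esub> (b \<odot>\<^bsub>M\<^esub> x)) \<in> ?G" if "r \<in> carrier R" for r using that by blast
  obtain h where h: "h \<in> mod_end R M" and hG: "\<And>u v. (u, v) \<in> ?G \<Longrightarrow> h u = v"
  proof (rule linear_relation_extends[of ?G])
    show "(\<zero>\<^bsub>M\<^esub>, \<zero>\<^bsub>M\<^esub>) \<in> ?G" using GI[OF R.zero_closed] axc bxc by simp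
    show "(u \<oplus>\<^bsub>M\<^esub> u', v \<oplus>\<^bsub>M\<^esub> v') \<in> ?G" if uv: "(u, v) \<in> ?G" "(u', v') \<in> ?G" for u v u' v'
    proof -
      from uv obtain r r' where "r \<in> carrier R" "r' \<in> carrier R"
        "u = r \<odot>\<^bsub>M\<^esub> (a \<odot>\<^bsub>M\<^esub> x)" "v = r \<odot>\<^bsub>M\<^esub> (b \<odot>\<^bsub>M\<^esub> x)" "u' = r' \<odot>\<^bsub>M\<^esub> (a \<odot>\<^bsub>M\<^esub> x)" "v' = r' \<odot>\<^bsub>M\<^esub> (b \<odot>\<^bsub>M\<^esub> x)" by blast
      thus ?thesis using GI[of "r \<oplus>\<^bsub>R\<^esub> r'"] axc bxc by (simp add: smult_l_distr)
    qed
    show "(s \<odot>\<^bsub>M\<^esub> u, s \<odot>\<^bsub>M\<^esub> v) \<in> ?G" if s: "s \<in> carrier R" and uv: "(u, v) \<in> ?G" for s u v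
    proof -
      from uv obtain r where "r \<in> carrier R" "u = r \<odot>\<^bsub>M\<^esub> (a \<odot>\<^bsub>M\<^esub> x)" "v = r \<odot>\<^bsub>M\<^esub> (b \<odot>\<^bsub>M\<^esub> x)" by blast
      thus ?thesis using GI[of "s \<otimes>\<^bsub>R\<^esub> r"] s axc bxc by (simp add: smult_assoc1)
    qed
    show "v = \<zero>\<^bsub>M\<^esub>" if "(\<zero>\<^bsub>M\<^esub>, v) \<in> ?G" for v using that ann_eq by (force simp: ann_def)
  qed (use axc bxc in auto)
  note hh = mod_endD[OF h]
  have \<pi>x: "\<pi> x \<in> H"
  proof (rule projection_stable[OF \<pi> idem h _ x])
    fix y assume y: "y \<in> carrier M" "h (\<pi> y) \<ominus>\<^bsub>M\<^esub> \<pi> (h (\<pi> y)) = \<zero>\<^bsub>M\<^esub>"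
    show "\<pi> y = \<zero>\<^bsub>M\<^esub>"
    proof (rule ccontr)
      assume "\<pi> y \<noteq> \<zero>\<^bsub>M\<^esub>"
      \<comment> \<open>Some nonzero multiple of \<open>\<pi> y\<close> is \<open>t a x\<close>, and
        \<open>h\<close> maps it to \<open>t b x\<close>. That value is fixed by
        \<open>\<pi>\<close> by the choice of \<open>y\<close> and killed by \<open>\<pi>\<close>
        because it lies in \<open>B\<close>; so \<open>t\<close> kills \<open>b x\<close>, hence
        also \<open>a x\<close>.\<close>
      then obtain r t where r: "r \<in> carrier R" "t \<in> carrier R" "r \<odot>\<^bsub>M\<^esub> \<pi> y = t \<odot>\<^bsub>M\<^esub> (a \<odot>\<^bsub>M\<^esub> x)"
        "t \<odot>\<^bsub>M\<^esub> (a \<odot>\<^bsub>M\<^esub> x) \<noteq> \<zero>\<^bsub>M\<^esub>" using ess[OF y(1)] unfolding A_def by force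
      have ht: "h (r \<odot>\<^bsub>M\<^esub> \<pi> y) = t \<odot>\<^bsub>M\<^esub> (b \<odot>\<^bsub>M\<^esub> x)" unfolding r(3) by (rule hG[OF GI[OF r(2)]])
      have "h (\<pi> y) = \<pi> (h (\<pi> y))" using y diff_eq_zero_iff p hh by simp
      hence "r \<odot>\<^bsub>M\<^esub> h (\<pi> y) = r \<odot>\<^bsub>M\<^esub> \<pi> (h (\<pi> y))" by simp
      hence "h (r \<odot>\<^bsub>M\<^esub> \<pi> y) = \<pi> (h (r \<odot>\<^bsub>M\<^esub> \<pi> y))" using r(1) y(1) by (simp add: p hh idem)
      also have "\<dots> = \<zero>\<^bsub>M\<^esub>" unfolding ht by (rule \<pi>B) (use r(2) in \<open>auto simp: B_def\<close>)
      finally have "t \<in> ann (b \<odot>\<^bsub>M\<^esub> x)" using r(2) ht by (simp add: ann_def)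
      thus False using r(4) ann_eq by (auto simp: ann_def)
    qed
  qed auto
  have le: "ann x \<subseteq> ann (\<pi> x)"
    using xc by (auto simp: ann_def p(4) simp flip: p(3))
  \<comment> \<open>Strictness: \<open>\<pi>\<close> kills \<open>b x\<close>, so \<open>b\<close>
    kills \<open>\<pi> x\<close>; and \<open>\<pi>\<close> fixes \<open>a x\<close>, so
    \<open>a\<close> kills \<open>x - \<pi> x\<close>.\<close>
  moreover have "b \<in> ann (\<pi> x)" "b \<notin> ann x"
    using b xc bx \<pi>B[OF B(2)] by (auto simp: ann_def simp flip: p(3))
  ultimately have lt1: "ann x \<subset> ann (\<pi> x)" by blast
  have "ann x \<subseteq> ann (x \<ominus>\<^bsub>M\<^esub> \<pi> x)"
    using le xc p(1) by (auto simp: ann_def smult_r_diff diff_self)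
  moreover have "a \<in> ann (x \<ominus>\<^bsub>M\<^esub> \<pi> x)" "a \<notin> ann x"
    using a xc ax \<pi>A[OF A(2)] p(1) p(3)[OF a xc] by (auto simp: ann_def smult_r_diff diff_self)
  ultimately have lt2: "ann x \<subset> ann (x \<ominus>\<^bsub>M\<^esub> \<pi> x)" by blast
  show thesis by (rule that[OF \<pi>x lt1 lt2])
qed

text \<open>The two elements are first replaced by multiples \<open>p x\<close> and
  \<open>q x\<close> whose annihilators are maximal among those of their nonzero multiples.
  Comparing these annihilators decides between \<open>split_equal_annihilators\<close> and
  \<open>split_along_scalar\<close>.\<close>

lemma split_nonuniform:
  assumes noeth: "noetherian_ring R"
    and x: "x \<in> H" and a: "a \<in> carrier R" and b: "b \<in> carrier R"
    and ax: "a \<odot>\<^bsub>M\<^esub> x \<noteq> \<zero>\<^bsub>M\<^esub>" and bx: "b \<odot>\<^bsub>M\<^esub> x \<noteq> \<zero>\<^bsub>M\<^esub>"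
    and indep: "\<And>r t. r \<in> carrier R \<Longrightarrow> t \<in> carrier R \<Longrightarrow> r \<odot>\<^bsub>M\<^esub> (a \<odot>\<^bsub>M\<^esub> x) = t \<odot>\<^bsub>M\<^esub> (b \<odot>\<^bsub>M\<^esub> x) \<Longrightarrow>
      r \<odot>\<^bsub>M\<^esub> (a \<odot>\<^bsub>M\<^esub> x) = \<zero>\<^bsub>M\<^esub>"
  obtains y where "y \<in> H" "ann x \<subset> ann y" "ann x \<subset> ann (x \<ominus>\<^bsub>M\<^esub> y)"
proof -
  interpret noetherian_ring R by fact
  have xc: "x \<in> carrier M" using x H(1) by simp
  \<comment> \<open>Primality of the annihilator takes this form: every nonzero multiple of the
    chosen element has the same annihilator.\<close>
  have max: "\<exists>c\<in>carrier R. c \<odot>\<^bsub>M\<^esub> (d \<odot>\<^bsub>M\<^esub> x) \<noteq> \<zero>\<^bsub>M\<^esub> \<and>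
      (\<forall>r\<in>carrier R. r \<odot>\<^bsub>M\<^esub> (c \<odot>\<^bsub>M\<^esub> (d \<odot>\<^bsub>M\<^esub> x)) \<noteq> \<zero>\<^bsub>M\<^esub> \<longrightarrow> ann (r \<odot>\<^bsub>M\<^esub> (c \<odot>\<^bsub>M\<^esub> (d \<odot>\<^bsub>M\<^esub> x))) = ann (c \<odot>\<^bsub>M\<^esub> (d \<odot>\<^bsub>M\<^esub> x)))"
    if d: "d \<in> carrier R" "d \<odot>\<^bsub>M\<^esub> x \<noteq> \<zero>\<^bsub>M\<^esub>" for d
  proof -
    let ?F = "{ann (c \<odot>\<^bsub>M\<^esub> (d \<odot>\<^bsub>M\<^esub> x)) |c. c \<in> carrier R \<and> c \<odot>\<^bsub>M\<^esub> (d \<odot>\<^bsub>M\<^esub> x) \<noteq> \<zero>\<^bsub>M\<^esub>}"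
    have dx: "d \<odot>\<^bsub>M\<^esub> x \<in> carrier M" using d xc by simp
    have "\<one>\<^bsub>R\<^esub> \<odot>\<^bsub>M\<^esub> (d \<odot>\<^bsub>M\<^esub> x) \<noteq> \<zero>\<^bsub>M\<^esub>" using d dx by simp
    hence "?F \<noteq> {}" by blast
    moreover have "ideal J R" if "J \<in> ?F" for J using that ann_ideal smult_closed[OF _ dx] by blast
    ultimately have "\<exists>I\<in>?F. \<forall>J\<in>?F. I \<subseteq> J \<longrightarrow> J = I" by (rule ideal_family_maximal)
    then obtain I where "I \<in> ?F" and I: "\<forall>J\<in>?F. I \<subseteq> J \<longrightarrow> J = I" by (rule bexE)
    then obtain c where c: "c \<in> carrier R" "c \<odot>\<^bsub>M\<^esub> (d \<odot>\<^bsub>M\<^esub> x) \<noteq> \<zero>\<^bsub>M\<^esub>" "I = ann (c \<odot>\<^bsub>M\<^esub> (d \<odot>\<^bsub>M\<^esub> x))" by blast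
    have "ann (r \<odot>\<^bsub>M\<^esub> (c \<odot>\<^bsub>M\<^esub> (d \<odot>\<^bsub>M\<^esub> x))) = ann (c \<odot>\<^bsub>M\<^esub> (d \<odot>\<^bsub>M\<^esub> x))"
      if r: "r \<in> carrier R" "r \<odot>\<^bsub>M\<^esub> (c \<odot>\<^bsub>M\<^esub> (d \<odot>\<^bsub>M\<^esub> x)) \<noteq> \<zero>\<^bsub>M\<^esub>" for r
    proof -
      have eq: "r \<odot>\<^bsub>M\<^esub> (c \<odot>\<^bsub>M\<^esub> (d \<odot>\<^bsub>M\<^esub> x)) = (r \<otimes>\<^bsub>R\<^esub> c) \<odot>\<^bsub>M\<^esub> (d \<odot>\<^bsub>M\<^esub> x)"
        using r(1) c(1) dx by (simp add: smult_assoc1)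
      have "ann (r \<odot>\<^bsub>M\<^esub> (c \<odot>\<^bsub>M\<^esub> (d \<odot>\<^bsub>M\<^esub> x))) \<in> ?F"
        using r c(1) unfolding eq by blast
      with I have "I \<subseteq> ann (r \<odot>\<^bsub>M\<^esub> (c \<odot>\<^bsub>M\<^esub> (d \<odot>\<^bsub>M\<^esub> x))) \<longrightarrow> ann (r \<odot>\<^bsub>M\<^esub> (c \<odot>\<^bsub>M\<^esub> (d \<odot>\<^bsub>M\<^esub> x))) = I" by (rule bspec)
      thus ?thesis unfolding c(3) using ann_smult_mono[OF smult_closed[OF c(1) dx] r(1)] by simp
    qed
    thus ?thesis using c by blast
  qed
  obtain a' where a': "a' \<in> carrier R" "a' \<odot>\<^bsub>M\<^esub> (a \<odot>\<^bsub>M\<^esub> x) \<noteq> \<zero>\<^bsub>M\<^esub>"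
    and maxa: "\<And>r. r \<in> carrier R \<Longrightarrow> r \<odot>\<^bsub>M\<^esub> (a' \<odot>\<^bsub>M\<^esub> (a \<odot>\<^bsub>M\<^esub> x)) \<noteq> \<zero>\<^bsub>M\<^esub> \<Longrightarrow>
      ann (r \<odot>\<^bsub>M\<^esub> (a' \<odot>\<^bsub>M\<^esub> (a \<odot>\<^bsub>M\<^esub> x))) = ann (a' \<odot>\<^bsub>M\<^esub> (a \<odot>\<^bsub>M\<^esub> x))"
    using max[OF a ax] by blast
  obtain b' where b': "b' \<in> carrier R" "b' \<odot>\<^bsub>M\<^esub> (b \<odot>\<^bsub>M\<^esub> x) \<noteq> \<zero>\<^bsub>M\<^esub>"
    and maxb: "\<And>r. r \<in> carrier R \<Longrightarrow> r \<odot>\<^bsub>M\<^esub> (b' \<odot>\<^bsub>M\<^esub> (b \<odot>\<^bsub>M\<^esub> x)) \<noteq> \<zero>\<^bsub>M\<^esub> \<Longrightarrow>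
      ann (r \<odot>\<^bsub>M\<^esub> (b' \<odot>\<^bsub>M\<^esub> (b \<odot>\<^bsub>M\<^esub> x))) = ann (b' \<odot>\<^bsub>M\<^esub> (b \<odot>\<^bsub>M\<^esub> x))"
    using max[OF b bx] by blast
  define p where "p = a' \<otimes>\<^bsub>R\<^esub> a"
  define q where "q = b' \<otimes>\<^bsub>R\<^esub> b"
  have p: "p \<in> carrier R" "a' \<odot>\<^bsub>M\<^esub> (a \<odot>\<^bsub>M\<^esub> x) = p \<odot>\<^bsub>M\<^esub> x" using a a' xc by (auto simp: p_def smult_assoc1)
  have q: "q \<in> carrier R" "b' \<odot>\<^bsub>M\<^esub> (b \<odot>\<^bsub>M\<^esub> x) = q \<odot>\<^bsub>M\<^esub> x" using b b' xc by (auto simp: q_def smult_assoc1)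
  note maxp = maxa[unfolded p(2)] and maxq = maxb[unfolded q(2)]
  have px: "p \<odot>\<^bsub>M\<^esub> x \<noteq> \<zero>\<^bsub>M\<^esub>" and qx: "q \<odot>\<^bsub>M\<^esub> x \<noteq> \<zero>\<^bsub>M\<^esub>" using a'(2) b'(2) p(2) q(2) by auto
  \<comment> \<open>If \<open>s\<close> does not kill \<open>e x\<close>, it kills no nonzero
    multiple of it either; by induction no power of \<open>s\<close> kills \<open>e x\<close>, let
    alone \<open>x\<close>.\<close>
  have powers: "(s [^]\<^bsub>R\<^esub> (n::nat)) \<odot>\<^bsub>M\<^esub> x \<noteq> \<zero>\<^bsub>M\<^esub>"
    if s: "s \<in> carrier R" and e: "e \<in> carrier R" "s \<odot>\<^bsub>M\<^esub> (e \<odot>\<^bsub>M\<^esub> x) \<noteq> \<zero>\<^bsub>M\<^esub>"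
      and maxe: "\<And>r. r \<in> carrier R \<Longrightarrow> r \<odot>\<^bsub>M\<^esub> (e \<odot>\<^bsub>M\<^esub> x) \<noteq> \<zero>\<^bsub>M\<^esub> \<Longrightarrow> ann (r \<odot>\<^bsub>M\<^esub> (e \<odot>\<^bsub>M\<^esub> x)) = ann (e \<odot>\<^bsub>M\<^esub> x)"
    for s e n
  proof -
    have ex: "e \<odot>\<^bsub>M\<^esub> x \<in> carrier M" using e xc by simp
    have sn: "s [^]\<^bsub>R\<^esub> (n::nat) \<in> carrier R" for n using s by simp
    have "(s [^]\<^bsub>R\<^esub> n) \<odot>\<^bsub>M\<^esub> (e \<odot>\<^bsub>M\<^esub> x) \<noteq> \<zero>\<^bsub>M\<^esub>"
    proof (induction n)
      case 0
      thus ?case using e ex s by auto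
    next
      case (Suc n)
      hence "s \<notin> ann ((s [^]\<^bsub>R\<^esub> n) \<odot>\<^bsub>M\<^esub> (e \<odot>\<^bsub>M\<^esub> x))" using maxe[OF sn] e(2) by (simp add: ann_def)
      thus ?case using s sn ex by (simp add: ann_def smult_assoc1 smult_comm[of s])
    qed
    moreover have "(s [^]\<^bsub>R\<^esub> n) \<odot>\<^bsub>M\<^esub> (e \<odot>\<^bsub>M\<^esub> x) = e \<odot>\<^bsub>M\<^esub> ((s [^]\<^bsub>R\<^esub> n) \<odot>\<^bsub>M\<^esub> x)"
      using smult_comm[OF sn e(1) xc] .
    ultimately show ?thesis using e(1) by auto
  qed
  consider "ann (p \<odot>\<^bsub>M\<^esub> x) = ann (q \<odot>\<^bsub>M\<^esub> x)"
    | s where "s \<in> ann (p \<odot>\<^bsub>M\<^esub> x)" "s \<notin> ann (q \<odot>\<^bsub>M\<^esub> x)"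
    | s where "s \<in> ann (q \<odot>\<^bsub>M\<^esub> x)" "s \<notin> ann (p \<odot>\<^bsub>M\<^esub> x)" by blast
  thus thesis
  proof cases
    case 1
    show thesis
    proof (rule split_equal_annihilators[OF x p(1) q(1) px qx _ 1])
      fix r t assume r: "r \<in> carrier R" "t \<in> carrier R" "r \<odot>\<^bsub>M\<^esub> (p \<odot>\<^bsub>M\<^esub> x) = t \<odot>\<^bsub>M\<^esub> (q \<odot>\<^bsub>M\<^esub> x)"
      \<comment> \<open>The hypothesis \<open>indep\<close> concerns \<open>a x\<close> and
        \<open>b x\<close>, so the factors \<open>a'\<close> and \<open>b'\<close> are moved into
        the scalars.\<close>
      have 2: "r \<odot>\<^bsub>M\<^esub> (p \<odot>\<^bsub>M\<^esub> x) = (r \<otimes>\<^bsub>R\<^esub> a') \<odot>\<^bsub>M\<^esub> (a \<odot>\<^bsub>M\<^esub> x)" "t \<odot>\<^bsub>M\<^esub> (q \<odot>\<^bsub>M\<^esub> x) = (t \<otimes>\<^bsub>R\<^esub> b') \<odot>\<^bsub>M\<^esub> (b \<odot>\<^bsub>M\<^esub> x)"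
        using r a a' b b' xc by (auto simp: smult_assoc1 simp flip: p(2) q(2))
      show "r \<odot>\<^bsub>M\<^esub> (p \<odot>\<^bsub>M\<^esub> x) = \<zero>\<^bsub>M\<^esub>"
        using indep[of "r \<otimes>\<^bsub>R\<^esub> a'" "t \<otimes>\<^bsub>R\<^esub> b'"] r a' b' unfolding 2 by simp
    qed (use that in blast)
  next
    \<comment> \<open>Here \<open>s\<close> kills \<open>p x\<close>, and \<open>q x\<close>
      guarantees that no power of \<open>s\<close> kills \<open>x\<close>; the last case is
      symmetric.\<close>
    case (2 s)
    hence s: "s \<in> carrier R" "s \<odot>\<^bsub>M\<^esub> (p \<odot>\<^bsub>M\<^esub> x) = \<zero>\<^bsub>M\<^esub>" by (auto simp: ann_def)
    hence "s \<odot>\<^bsub>M\<^esub> (q \<odot>\<^bsub>M\<^esub> x) \<noteq> \<zero>\<^bsub>M\<^esub>" using 2 by (simp add: ann_def)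
    from split_along_scalar[OF noeth x s(1) p(1) s(2) px powers[OF s(1) q(1) this maxq]] that
    show thesis by blast
  next
    case (3 s)
    hence s: "s \<in> carrier R" "s \<odot>\<^bsub>M\<^esub> (q \<odot>\<^bsub>M\<^esub> x) = \<zero>\<^bsub>M\<^esub>" by (auto simp: ann_def)
    hence "s \<odot>\<^bsub>M\<^esub> (p \<odot>\<^bsub>M\<^esub> x) \<noteq> \<zero>\<^bsub>M\<^esub>" using 3 by (simp add: ann_def)
    from split_along_scalar[OF noeth x s(1) q(1) s(2) qx powers[OF s(1) p(1) this maxp]] that
    show thesis by blast
  qed
qed

text \<open>The induction is run on a counterexample \<open>z\<close> whose annihilator is maximal.
  Once \<open>z\<close> is split into \<open>y\<close> and \<open>z - y\<close> in \<open>H\<close>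
  with larger annihilators, \<open>f\<close> maps both parts into \<open>H\<close>, hence also their
  sum.\<close>

lemma end_stable:
  assumes noeth: "noetherian_ring R" and x: "x \<in> H" and f: "f \<in> mod_end R M"
  shows "f x \<in> H"
proof (rule ccontr)
  interpret noetherian_ring R by fact
  note F = mod_endD[OF f]
  assume "f x \<notin> H"
  hence "{ann y |y. y \<in> H \<and> f y \<notin> H} \<noteq> {}" using x by blast
  moreover have "ideal J R" if "J \<in> {ann y |y. y \<in> H \<and> f y \<notin> H}" for J
    using that ann_ideal H(1) by blast
  ultimately have "\<exists>I\<in>{ann y |y. y \<in> H \<and> f y \<notin> H}. \<forall>J\<in>{ann y |y. y \<in> H \<and> f y \<notin> H}. I \<subseteq> J \<longrightarrow> J = I"
    by (rule ideal_family_maximal)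
  then obtain I where "I \<in> {ann y |y. y \<in> H \<and> f y \<notin> H}"
    and I: "\<forall>J\<in>{ann y |y. y \<in> H \<and> f y \<notin> H}. I \<subseteq> J \<longrightarrow> J = I" by (rule bexE)
  then obtain z where z: "z \<in> H" "f z \<notin> H" "I = ann z" by blast
  have larger: "f y \<in> H" if "y \<in> H" "ann z \<subset> ann y" for y
  proof (rule ccontr)
    assume "f y \<notin> H"
    hence "ann y \<in> {ann y |y. y \<in> H \<and> f y \<notin> H}" using that(1) by blast
    with I have "I \<subseteq> ann y \<longrightarrow> ann y = I" by (rule bspec)
    thus False using that(2) unfolding z(3) by (simp add: psubset_eq)
  qed
  \<comment> \<open>By \<open>uniform_stable\<close> the counterexample cannot generate a uniform
    submodule, and failure of uniformity at some \<open>a\<close>, \<open>b\<close> is exactly the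
    independence that \<open>split_nonuniform\<close> needs.\<close>
  have "\<exists>y. y \<in> H \<and> ann z \<subset> ann y \<and> ann z \<subset> ann (z \<ominus>\<^bsub>M\<^esub> y)"
  proof (rule ccontr)
    assume no: "\<not> ?thesis"
    have "f z \<in> H"
    proof (rule uniform_stable[OF z(1) f], rule ccontr)
      fix a b assume ab: "a \<in> carrier R" "b \<in> carrier R" "a \<odot>\<^bsub>M\<^esub> z \<noteq> \<zero>\<^bsub>M\<^esub>" "b \<odot>\<^bsub>M\<^esub> z \<noteq> \<zero>\<^bsub>M\<^esub>"
        and neg: "\<not> (\<exists>r\<in>carrier R. \<exists>t\<in>carrier R. r \<odot>\<^bsub>M\<^esub> (a \<odot>\<^bsub>M\<^esub> z) = t \<odot>\<^bsub>M\<^esub> (b \<odot>\<^bsub>M\<^esub> z) \<and> r \<odot>\<^bsub>M\<^esub> (a \<odot>\<^bsub>M\<^esub> z) \<noteq> \<zero>\<^bsub>M\<^esub>)"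
      show False
      proof (rule split_nonuniform[OF noeth z(1) ab])
        show "r \<odot>\<^bsub>M\<^esub> (a \<odot>\<^bsub>M\<^esub> z) = \<zero>\<^bsub>M\<^esub>"
          if "r \<in> carrier R" "t \<in> carrier R" "r \<odot>\<^bsub>M\<^esub> (a \<odot>\<^bsub>M\<^esub> z) = t \<odot>\<^bsub>M\<^esub> (b \<odot>\<^bsub>M\<^esub> z)" for r t
          using neg that by blast
        show False if "y \<in> H" "ann z \<subset> ann y" "ann z \<subset> ann (z \<ominus>\<^bsub>M\<^esub> y)" for y
          using no that by blast
      qed
    qed
    with z(2) show False by contradiction
  qed
  then obtain y where y: "y \<in> H" "ann z \<subset> ann y" "ann z \<subset> ann (z \<ominus>\<^bsub>M\<^esub> y)" by blast
  have "f y \<oplus>\<^bsub>M\<^esub> f (z \<ominus>\<^bsub>M\<^esub> y) \<in> H"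
    using larger[OF y(1,2)] larger[OF H(4)[OF z(1) y(1)] y(3)] by (rule H(3))
  moreover have "f y \<oplus>\<^bsub>M\<^esub> f (z \<ominus>\<^bsub>M\<^esub> y) = f z"
    using add_diff_cancel(1) F(1,6) H(1) y(1) z(1) by simp
  ultimately show False using z(2) by simp
qed

end

theorem theorem4p11:
  fixes R :: "('r, 'p) ring_scheme"
    and M :: "('r, 'm, 'q) module_scheme"
    and E :: "('r, 'e, 's) module_scheme"
    and i :: "'m \<Rightarrow> 'e"
  assumes "cring R" and "noetherian_ring R"
    and "module R M"
    and "injective_envelope R M E i"
    and "automorphism_invariant R M E i"
  shows "quasi_injective R M E i"
proof -
  have inj: "injective_module R E" and sub: "submodule (i ` carrier M) R E"
    using assms(4) by (auto simp: injective_envelope_def essential_submodule_def)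
  \<comment> \<open>The image of \<open>M\<close> in \<open>E\<close> takes the role of
    \<open>H\<close>; automorphism invariance is the stability assumption of the locale.\<close>
  interpret aut_stable_submodule R E "i ` carrier M"
  proof (intro aut_stable_submodule.intro injective_mod.intro injective_mod_axioms.intro
      aut_stable_submodule_axioms.intro)
    show "module R E" using inj by (simp add: injective_module_def)
    show "f x \<in> i ` carrier M" if "f \<in> mod_aut R E" "x \<in> i ` carrier M" for f x
      using assms(5) that unfolding automorphism_invariant_def by blast
  qed (fact inj sub)+
  show ?thesis
    unfolding quasi_injective_def using end_stable[OF assms(2)] by blast
qed

end
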